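(* Let $(R,\mathfrak{m})$ be a noetherian local domain which is analytically unramified in co-dimension one. If $R$ satisfies $(S_2)$, then the $R$-module $\overline{R}/R$ is $h$-reduced.
   Context: $Q=Q(R)$ is the fraction field of the domain $R$ and $\overline{R}$ is the integral closure of $R$ in $Q$. An $R$-module $M$ is $h$-reduced if $\operatorname{Hom}_R(Q,M)=0$. $R$ is analytically unramified in co-dimension one if for every prime $\mathfrak{p}$ of height one the local ring $R_{\mathfrak{p}}$ is analytically unramified (its completion is reduced). $(S_2)$ means $\operatorname{depth}(R_{\mathfrak{p}})\geq\min\{2,\operatorname{ht}(\mathfrak{p})\}$ for all $\mathfrak{p}\in\operatorname{Spec}(R)$. *)

theory Defs
  imports "HOL-Algebra.Algebra" "HOL-Library.Extended_Nat"
begin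

section \<open>Local rings and localization\<close>

definition local_ring :: "('a, 'm) ring_scheme \<Rightarrow> 'a set \<Rightarrow> bool"
  where "local_ring A M \<longleftrightarrow> cring A \<and> {I. maximalideal I A} = {M}"

definition max_ideal :: "('a, 'm) ring_scheme \<Rightarrow> 'a set"
  where "max_ideal A = (THE M. maximalideal M A)"

text \<open>The fraction \<open>a / s\<close> is the class of \<open>(a, s)\<close> for the usual equivalence relation on
  \<open>carrier R \<times> S\<close>. The sum of two classes is the union, over all pairs of representatives,
  of the classes of the sums; these classes coincide. Likewise for products, as in \<^const>\<open>rcoset_mult\<close>.\<close>

definition loc_frac :: "('a, 'm) ring_scheme \<Rightarrow> 'a set \<Rightarrow> 'a \<Rightarrow> 'a \<Rightarrow> ('a \<times> 'a) set"
  where "loc_frac R S a s =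
    {(b, t). b \<in> carrier R \<and> t \<in> S \<and>
       (\<exists>u\<in>S. u \<otimes>\<^bsub>R\<^esub> (t \<otimes>\<^bsub>R\<^esub> a) = u \<otimes>\<^bsub>R\<^esub> (s \<otimes>\<^bsub>R\<^esub> b))}"

definition localization :: "('a, 'm) ring_scheme \<Rightarrow> 'a set \<Rightarrow> ('a \<times> 'a) set ring"
  where "localization R S =
    \<lparr>carrier = {loc_frac R S a s | a s. a \<in> carrier R \<and> s \<in> S},
     monoid.mult = (\<lambda>U V. \<Union>x\<in>U. \<Union>y\<in>V.
       loc_frac R S (fst x \<otimes>\<^bsub>R\<^esub> fst y) (snd x \<otimes>\<^bsub>R\<^esub> snd y)),
     monoid.one = loc_frac R S \<one>\<^bsub>R\<^esub> \<one>\<^bsub>R\<^esub>,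
     ring.zero = loc_frac R S \<zero>\<^bsub>R\<^esub> \<one>\<^bsub>R\<^esub>,
     ring.add = (\<lambda>U V. \<Union>x\<in>U. \<Union>y\<in>V.
       loc_frac R S ((snd y \<otimes>\<^bsub>R\<^esub> fst x) \<oplus>\<^bsub>R\<^esub> (snd x \<otimes>\<^bsub>R\<^esub> fst y))
         (snd x \<otimes>\<^bsub>R\<^esub> snd y))\<rparr>"

definition localization_at :: "('a, 'm) ring_scheme \<Rightarrow> 'a set \<Rightarrow> ('a \<times> 'a) set ring"
  where "localization_at R P = localization R (carrier R - P)"

definition frac_field :: "('a, 'm) ring_scheme \<Rightarrow> ('a \<times> 'a) set ring"
  where "frac_field R = localization R (carrier R - {\<zero>\<^bsub>R\<^esub>})"

definition frac_embed :: "('a, 'm) ring_scheme \<Rightarrow> 'a \<Rightarrow> ('a \<times> 'a) set"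
  where "frac_embed R r = loc_frac R (carrier R - {\<zero>\<^bsub>R\<^esub>}) r \<one>\<^bsub>R\<^esub>"


section \<open>Height, depth and the condition \<open>(S\<^sub>2)\<close>\<close>

definition prime_height :: "('a, 'm) ring_scheme \<Rightarrow> 'a set \<Rightarrow> enat"
  where "prime_height R P =
    Sup {enat n | n. \<exists>c :: nat \<Rightarrow> 'a set.
      (\<forall>i\<le>n. primeideal (c i) R) \<and> (\<forall>i<n. c i \<subset> c (Suc i)) \<and> c n = P}"

text \<open>Each \<open>xs ! i\<close> is a nonzerodivisor modulo the ideal generated by its predecessors. The
  customary condition that the whole sequence generates a proper ideal is automatic below, where
  the sequences lie in the maximal ideal.\<close>

definition regular_sequence :: "('a, 'm) ring_scheme \<Rightarrow> 'a list \<Rightarrow> bool"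
  where "regular_sequence A xs \<longleftrightarrow> set xs \<subseteq> carrier A \<and>
    (\<forall>i<length xs. \<forall>a\<in>carrier A.
       xs ! i \<otimes>\<^bsub>A\<^esub> a \<in> Idl\<^bsub>A\<^esub> (set (take i xs)) \<longrightarrow> a \<in> Idl\<^bsub>A\<^esub> (set (take i xs)))"

definition local_depth :: "('a, 'm) ring_scheme \<Rightarrow> enat"
  where "local_depth A =
    Sup {enat (length xs) | xs. set xs \<subseteq> max_ideal A \<and> regular_sequence A xs}"

definition serre_S2 :: "('a, 'm) ring_scheme \<Rightarrow> bool"
  where "serre_S2 R \<longleftrightarrow>
    (\<forall>P. primeideal P R \<longrightarrow> local_depth (localization_at R P) \<ge> min 2 (prime_height R P))"


section \<open>Completion\<close>

text \<open>The inverse limit of the rings \<open>A / I\<^sup>n\<close>. The projection from \<open>A / I\<^sup>n\<^sup>+\<^sup>1\<close> to \<open>A / I\<^sup>n\<close> sends a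
  coset to the unique coset containing it, so the condition \<open>f (Suc n) \<subseteq> f n\<close> expresses
  compatibility.\<close>

definition adic_completion :: "('a, 'm) ring_scheme \<Rightarrow> 'a set \<Rightarrow> (nat \<Rightarrow> 'a set) ring"
  where "adic_completion A I = (let Q = (\<lambda>n::nat. A Quot (I [^]\<^bsub>ideals_set A\<^esub> n)) in
    \<lparr>carrier = {f. \<forall>n. f n \<in> carrier (Q n) \<and> f (Suc n) \<subseteq> f n},
     monoid.mult = (\<lambda>f g n. f n \<otimes>\<^bsub>Q n\<^esub> g n),
     monoid.one = (\<lambda>n. \<one>\<^bsub>Q n\<^esub>),
     ring.zero = (\<lambda>n. \<zero>\<^bsub>Q n\<^esub>),
     ring.add = (\<lambda>f g n. f n \<oplus>\<^bsub>Q n\<^esub> g n)\<rparr>)"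

definition reduced_ring :: "('a, 'm) ring_scheme \<Rightarrow> bool"
  where "reduced_ring A \<longleftrightarrow>
    (\<forall>x\<in>carrier A. \<forall>n::nat. x [^]\<^bsub>A\<^esub> n = \<zero>\<^bsub>A\<^esub> \<longrightarrow> x = \<zero>\<^bsub>A\<^esub>)"

definition analytically_unramified :: "('a, 'm) ring_scheme \<Rightarrow> bool"
  where "analytically_unramified A \<longleftrightarrow> reduced_ring (adic_completion A (max_ideal A))"

definition analytically_unramified_codim_one :: "('a, 'm) ring_scheme \<Rightarrow> bool"
  where "analytically_unramified_codim_one R \<longleftrightarrow>
    (\<forall>P. primeideal P R \<and> prime_height R P = 1 \<longrightarrow>
       analytically_unramified (localization_at R P))"


section \<open>The module \<open>R\<close>-bar modulo \<open>R\<close> and \<open>h\<close>-reducedness\<close>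

text \<open>The subset of \<^term>\<open>frac_field R\<close> of roots of monic polynomials with coefficients in the
  image of \<open>R\<close>.\<close>

definition integral_closure :: "('a, 'm) ring_scheme \<Rightarrow> ('a \<times> 'a) set set"
  where "integral_closure R =
    {x \<in> carrier (frac_field R).
       \<exists>p. p \<noteq> [] \<and> polynomial\<^bsub>frac_field R\<^esub> (frac_embed R ` carrier R) p \<and>
           lead_coeff p = \<one>\<^bsub>frac_field R\<^esub> \<and>
           ring.eval (frac_field R) p x = \<zero>\<^bsub>frac_field R\<^esub>}"

definition frac_module :: "('a, 'm) ring_scheme \<Rightarrow> ('a, ('a \<times> 'a) set) module"
  where "frac_module R = ring.extend (frac_field R)
    (module.fields (\<lambda>r x. frac_embed R r \<otimes>\<^bsub>frac_field R\<^esub> x))"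

text \<open>Modules in HOL-Algebra extend the ring record; the multiplicative fields of a module carry
  no meaning and are left unspecified here.\<close>

definition quotient_module :: "('r, 'a, 'm) module_scheme \<Rightarrow> 'a set \<Rightarrow> ('r, 'a set) module"
  where "quotient_module M N =
    \<lparr>carrier = a_rcosets\<^bsub>M\<^esub> N, monoid.mult = undefined, monoid.one = undefined,
     ring.zero = N, ring.add = set_add M,
     smult = (\<lambda>r U. \<Union>x\<in>U. N +>\<^bsub>M\<^esub> (r \<odot>\<^bsub>M\<^esub> x))\<rparr>"

definition integral_closure_mod_ring :: "('a, 'm) ring_scheme \<Rightarrow> ('a, ('a \<times> 'a) set set) module"
  where "integral_closure_mod_ring R =
    quotient_module ((frac_module R)\<lparr>carrier := integral_closure R\<rparr>) (frac_embed R ` carrier R)"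

definition mod_hom ::
    "('r, 'm) ring_scheme \<Rightarrow> ('r, 'a, 'k) module_scheme \<Rightarrow> ('r, 'b, 'l) module_scheme \<Rightarrow> ('a \<Rightarrow> 'b) set"
  where "mod_hom R M N =
    {f \<in> hom (add_monoid M) (add_monoid N).
       \<forall>r\<in>carrier R. \<forall>x\<in>carrier M. f (r \<odot>\<^bsub>M\<^esub> x) = r \<odot>\<^bsub>N\<^esub> f x}"

text \<open>\<open>Hom\<^sub>R(Q, M) = 0\<close>: HOL functions are total, so a homomorphism is zero when it vanishes on the
  carrier of \<open>Q\<close>.\<close>

definition h_reduced :: "('r, 'm) ring_scheme \<Rightarrow> ('r, 'b, 'l) module_scheme \<Rightarrow> bool"
  where "h_reduced R M \<longleftrightarrow>
    (\<forall>f\<in>mod_hom R (frac_module R) M. \<forall>q\<in>carrier (frac_module R). f q = \<zero>\<^bsub>M\<^esub>)"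

end

theory Submission
  imports Defs
begin

text \<open>
Let \<open>f\<close> be an \<open>R\<close>-linear map from the fraction field \<open>Q\<close> to the integral closure modulo \<open>R\<close>, and let
\<open>u / v\<close> with \<open>u, v \<in> R\<close> and \<open>v \<noteq> 0\<close> represent \<open>f q\<close>. The claim is that \<open>u \<in> vR\<close>.

The condition \<open>(S\<^sub>2)\<close> reduces this to primes \<open>P\<close> of height one: a noetherian domain with \<open>(S\<^sub>2)\<close> is
the intersection of its localizations at these primes (\<open>serre_S2_height_one_prime\<close>). So it suffices
to prove \<open>u \<in> vA\<close> where \<open>A\<close> is the localization at such a \<open>P\<close>, a one-dimensional local domain with
maximal ideal \<open>\<mm>\<close> and reduced completion.

Choose \<open>t \<noteq> 0\<close> in \<open>P\<close> and let \<open>y\<^sub>n\<close> represent \<open>f (q / t\<^sup>n)\<close>, with \<open>y\<^sub>0 = u / v\<close>. Linearity of \<open>f\<close> gives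
\<open>t y\<^sub>n\<^sub>+\<^sub>1 - y\<^sub>n = a\<^sub>n \<in> R\<close>. The elements \<open>w\<^sub>n = v t\<^sup>n y\<^sub>n\<close> therefore satisfy \<open>w\<^sub>0 = u\<close> and
\<open>w\<^sub>n\<^sub>+\<^sub>1 = w\<^sub>n + a\<^sub>n v t\<^sup>n\<close>: they lie in \<open>R\<close>, are congruent to \<open>u\<close> modulo \<open>v\<close>, and form a Cauchy sequence,
while \<open>w\<^sub>n / (v t\<^sup>n) = y\<^sub>n\<close> is integral over \<open>R\<close> (\<open>local_divisibility\<close>).

One could now invoke the theorem that the integral closure of an analytically unramified local
domain is a finite module. A bound on degrees serves the same purpose and is elementary: if \<open>e\<close> is
the length of \<open>A / tA\<close>, then every fraction that is integral over \<open>A\<close> satisfies a monic equation of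
degree \<open>e + 1\<close> (\<open>uniform_degree_bound\<close>). The equation of \<open>y\<^sub>n\<close>, multiplied by \<open>(v t\<^sup>n)\<^sup>e\<^sup>+\<^sup>1\<close>, shows
that the power of \<open>w\<^sub>n\<close> with exponent \<open>e + 1\<close> lies in \<open>t\<^sup>n A\<close>. So the limit of the sequence in the completion
is nilpotent, hence zero, and \<open>w\<^sub>n \<in> \<mm>\<^sup>n\<close> for all \<open>n\<close>. Because \<open>\<mm>\<^sup>n \<subseteq> vA\<close> for some \<open>n\<close>, this gives
\<open>w\<^sub>n \<in> vA\<close> and then \<open>u \<in> vA\<close> (\<open>integral_division_mem\<close>).
\<close>

section \<open>Colon ideals and length\<close>

context ring begin

definition colon :: "'a set \<Rightarrow> 'a \<Rightarrow> 'a set"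
  where "colon I a = {r \<in> carrier R. r \<otimes> a \<in> I}"

definition dilate :: "'a \<Rightarrow> 'a set \<Rightarrow> 'a set"
  where "dilate a I = {a \<otimes> r | r. r \<in> I}"

text \<open>\<open>length_le N L n\<close> says that \<open>L / N\<close> has length at most \<open>n\<close>. Chains are allowed to repeat, and only their
strict steps are counted: in this form the image of a chain under any monotone operation on
ideals is again a chain.\<close>

definition length_le :: "'a set \<Rightarrow> 'a set \<Rightarrow> nat \<Rightarrow> bool"
  where "length_le N L n \<longleftrightarrow>
    (\<forall>(c :: nat \<Rightarrow> 'a set) k. (\<forall>i. ideal (c i) R \<and> N \<subseteq> c i \<and> c i \<subseteq> L) \<longrightarrow> mono c \<longrightarrow>
       card {i. i < k \<and> c i \<noteq> c (Suc i)} \<le> n)"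

lemma ideal_subset: "ideal I R \<Longrightarrow> I \<subseteq> carrier R"
  by (meson additive_subgroup.a_subset ideal.axioms(1))

lemma set_addE:
  assumes "x \<in> I <+>\<^bsub>R\<^esub> J"
  obtains a b where "a \<in> I" "b \<in> J" "x = a \<oplus> b"
  using assms by (auto simp: set_add_def')

lemma set_addI: "a \<in> I \<Longrightarrow> b \<in> J \<Longrightarrow> a \<oplus> b \<in> I <+>\<^bsub>R\<^esub> J"
  by (auto simp: set_add_def')

lemma set_add_upper1: "ideal I R \<Longrightarrow> ideal J R \<Longrightarrow> I \<subseteq> I <+>\<^bsub>R\<^esub> J"
proof
  fix x assume a: "ideal I R" "ideal J R" "x \<in> I"
  have "x \<oplus> \<zero> \<in> I <+>\<^bsub>R\<^esub> J"
    using a by (intro set_addI) (simp_all add: additive_subgroup.zero_closed ideal.axioms(1))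
  then show "x \<in> I <+>\<^bsub>R\<^esub> J" using a by (simp add: ideal.Icarr)
qed

lemma set_add_upper2: "ideal I R \<Longrightarrow> ideal J R \<Longrightarrow> J \<subseteq> I <+>\<^bsub>R\<^esub> J"
proof
  fix x assume a: "ideal I R" "ideal J R" "x \<in> J"
  have "\<zero> \<oplus> x \<in> I <+>\<^bsub>R\<^esub> J"
    using a by (intro set_addI) (simp_all add: additive_subgroup.zero_closed ideal.axioms(1))
  then show "x \<in> I <+>\<^bsub>R\<^esub> J" using a by (simp add: ideal.Icarr)
qed

lemma set_add_least: "ideal K R \<Longrightarrow> I \<subseteq> K \<Longrightarrow> J \<subseteq> K \<Longrightarrow> I <+>\<^bsub>R\<^esub> J \<subseteq> K"
  by (auto elim!: set_addE intro: additive_subgroup.a_closed ideal.axioms(1))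

lemma set_add_mono: "I \<subseteq> I' \<Longrightarrow> J \<subseteq> J' \<Longrightarrow> I <+>\<^bsub>R\<^esub> J \<subseteq> I' <+>\<^bsub>R\<^esub> J'"
  by (auto elim!: set_addE intro: set_addI)

lemma set_add_diff:
  assumes "ideal K R" "a \<oplus> b \<in> K" "b \<in> K" "a \<in> carrier R"
  shows "a \<in> K"
proof -
  have b: "b \<in> carrier R" using assms ideal.Icarr by fast
  have "(a \<oplus> b) \<oplus> (\<ominus> b) \<in> K"
    using assms by (simp add: additive_subgroup.a_closed additive_subgroup.a_inv_closed ideal.axioms(1))
  then show ?thesis using b assms(4) by (simp add: a_assoc r_neg)
qed

lemma length_leI:
  assumes "\<And>c k. (\<And>i. ideal (c i) R) \<Longrightarrow> (\<And>i. N \<subseteq> c i) \<Longrightarrow> (\<And>i. c i \<subseteq> L) \<Longrightarrow> mono c \<Longrightarrow>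
       card {i. i < k \<and> c i \<noteq> c (Suc i)} \<le> n"
  shows "length_le N L n"
  using assms unfolding length_le_def by blast

lemma length_leD:
  assumes "length_le N L n" "\<And>i. ideal (c i) R" "\<And>i. N \<subseteq> c i" "\<And>i. c i \<subseteq> L" "mono c"
  shows "card {i. i < k \<and> c i \<noteq> c (Suc i)} \<le> n"
  using assms unfolding length_le_def by blast

text \<open>Subadditivity of the length. By the modular law a strict step of a chain stays strict after
intersecting with \<open>K\<close> or after adding \<open>K\<close>, so the steps are distributed over the two quotients.\<close>

lemma length_le_add:
  assumes "ideal K R" "N \<subseteq> K" "K \<subseteq> L" "ideal L R"
    and nk: "length_le N K m" and kl: "length_le K L n"
  shows "length_le N L (m + n)"
proof (rule length_leI)
  fix c :: "nat \<Rightarrow> 'a set" and k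
  assume c: "\<And>i. ideal (c i) R" "\<And>i. N \<subseteq> c i" "\<And>i. c i \<subseteq> L" "mono c"
  let ?D = "\<lambda>d :: nat \<Rightarrow> 'a set. {i. i < k \<and> d i \<noteq> d (Suc i)}"
  have "card (?D (\<lambda>i. c i \<inter> K)) \<le> m"
  proof (rule length_leD[OF nk])
    show "mono (\<lambda>i. c i \<inter> K)"
      by (intro monoI Int_mono monoD[OF c(4)] order_refl)
  qed (use c assms(1,2) in \<open>auto simp: i_intersect\<close>)
  moreover have "card (?D (\<lambda>i. c i <+>\<^bsub>R\<^esub> K)) \<le> n"
  proof (rule length_leD[OF kl])
    show "mono (\<lambda>i. c i <+>\<^bsub>R\<^esub> K)"
      by (intro monoI set_add_mono monoD[OF c(4)] order_refl)
  qed (use c assms in \<open>simp_all add: add_ideals set_add_upper2 set_add_least\<close>)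
  moreover have "?D c \<subseteq> ?D (\<lambda>i. c i \<inter> K) \<union> ?D (\<lambda>i. c i <+>\<^bsub>R\<^esub> K)"
  proof clarsimp
    fix i assume ne: "c i \<noteq> c (Suc i)" "c i <+>\<^bsub>R\<^esub> K = c (Suc i) <+>\<^bsub>R\<^esub> K"
      and eq: "c i \<inter> K = c (Suc i) \<inter> K"
    have sub: "c i \<subseteq> c (Suc i)" using monoD[OF c(4), of i "Suc i"] by simp
    have "c (Suc i) \<subseteq> c i"
    proof
      fix x assume x: "x \<in> c (Suc i)"
      have xc: "x \<in> carrier R" using c(1) x ideal.Icarr by fast
      have "x \<in> c i <+>\<^bsub>R\<^esub> K" using ne(2) set_add_upper1[OF c(1) assms(1)] x by blast
      then obtain a b where ab: "a \<in> c i" "b \<in> K" "x = a \<oplus> b" by (rule set_addE)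
      have abc: "a \<in> carrier R" "b \<in> carrier R" using ab c(1) assms(1) ideal.Icarr by fast+
      have "b \<in> c (Suc i)"
        using set_add_diff[OF c(1)[of "Suc i"], of b a] ab sub x abc by (auto simp: a_comm)
      then show "x \<in> c i" using ab eq c(1)
        by (metis Int_iff additive_subgroup.a_closed ideal.axioms(1))
    qed
    with sub ne show False by blast
  qed
  then have "card (?D c) \<le> card (?D (\<lambda>i. c i \<inter> K) \<union> ?D (\<lambda>i. c i <+>\<^bsub>R\<^esub> K))"
    by (intro card_mono) auto
  moreover have "\<dots> \<le> card (?D (\<lambda>i. c i \<inter> K)) + card (?D (\<lambda>i. c i <+>\<^bsub>R\<^esub> K))"
    by (rule card_Un_le)
  ultimately show "card (?D c) \<le> m + n" by linarith
qed

text \<open>The number \<open>m\<close> is the exact length of \<open>L / I\<close>. A chain from \<open>I\<close> to \<open>L\<close> that attains it can be put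
on top of any chain from \<open>N\<close> to \<open>I\<close>, which gives the remaining half of the additivity of length.\<close>

lemma length_le_exact:
  assumes "ideal I R" "I \<subseteq> L" "ideal L R" and fin: "length_le I L n"
  obtains m where "length_le I L m"
    and "\<And>N e. \<lbrakk>N \<subseteq> I; length_le N L (e + m)\<rbrakk> \<Longrightarrow> length_le N I e"
proof -
  define m where "m = (LEAST m. length_le I L m)"
  have m: "length_le I L m" unfolding m_def using fin by (rule LeastI)
  have "\<exists>c k. (\<forall>i. ideal (c i) R \<and> I \<subseteq> c i \<and> c i \<subseteq> L) \<and> mono c \<and>
       card {i. i < k \<and> c i \<noteq> c (Suc i)} \<ge> m"
  proof (cases m)
    case 0
    show ?thesis using assms by (intro exI[of _ "\<lambda>_. I"]) (auto simp: 0 intro: monoI)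
  next
    case (Suc m')
    then have "\<not> length_le I L m'"
      unfolding m_def by (metis Suc_n_not_le_n Least_le)
    then obtain c k where "\<forall>i. ideal (c i) R \<and> I \<subseteq> c i \<and> c i \<subseteq> L" "mono c"
       "\<not> card {i. i < k \<and> c i \<noteq> c (Suc i)} \<le> m'"
      unfolding length_le_def by blast
    then show ?thesis using Suc by (intro exI[of _ c] exI[of _ k]) auto
  qed
  then obtain c k where c: "\<And>i. ideal (c i) R" "\<And>i. I \<subseteq> c i" "\<And>i. c i \<subseteq> L" "mono c"
    and ck: "card {i. i < k \<and> c i \<noteq> c (Suc i)} \<ge> m" by blast
  have "length_le N I e" if "N \<subseteq> I" and tot: "length_le N L (e + m)" for N e
  proof (rule length_leI)
    fix d :: "nat \<Rightarrow> 'a set" and j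
    assume d: "\<And>i. ideal (d i) R" "\<And>i. N \<subseteq> d i" "\<And>i. d i \<subseteq> I" "mono d"
    define f where "f = (\<lambda>i. if i \<le> j then d i else c (i - Suc j))"
    have "mono f"
    proof (rule monoI)
      fix x y :: nat assume "x \<le> y"
      then show "f x \<le> f y"
        using subset_trans[OF d(3)[of x] c(2)[of "y - Suc j"]]
          monoD[OF d(4), of x y] monoD[OF c(4), of "x - Suc j" "y - Suc j"]
        unfolding f_def by auto
    qed
    have "card {i. i < j + Suc k \<and> f i \<noteq> f (Suc i)} \<le> e + m"
    proof (rule length_leD[OF tot])
      show "ideal (f i) R" for i using c(1) d(1) by (simp add: f_def)
      show "N \<subseteq> f i" for i
        using d(2)[of i] subset_trans[OF that(1) c(2)[of "i - Suc j"]] by (simp add: f_def)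
      show "f i \<subseteq> L" for i
        using c(3)[of "i - Suc j"] subset_trans[OF d(3)[of i] assms(2)] by (simp add: f_def)
    qed (fact \<open>mono f\<close>)
    moreover have "{i. i < j \<and> d i \<noteq> d (Suc i)} \<union> (\<lambda>i. i + Suc j) ` {i. i < k \<and> c i \<noteq> c (Suc i)}
       \<subseteq> {i. i < j + Suc k \<and> f i \<noteq> f (Suc i)}" (is "?X \<union> ?Y \<subseteq> ?Z")
      by (auto simp: f_def Suc_diff_le)
    then have "card (?X \<union> ?Y) \<le> card ?Z" by (intro card_mono) auto
    moreover have "card (?X \<union> ?Y) = card ?X + card ?Y"
      by (rule card_Un_disjoint) auto
    moreover have "card ?Y = card {i. i < k \<and> c i \<noteq> c (Suc i)}"
      by (rule card_image) (auto simp: inj_on_def)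
    ultimately show "card ?X \<le> e" using ck by linarith
  qed
  with m show thesis by (rule that)
qed

end

context cring begin

lemma cring_idealI:
  assumes sub: "I \<subseteq> carrier R" and "\<zero> \<in> I"
    and add: "\<And>x y. \<lbrakk>x \<in> I; y \<in> I\<rbrakk> \<Longrightarrow> x \<oplus> y \<in> I"
    and mult: "\<And>r x. \<lbrakk>r \<in> carrier R; x \<in> I\<rbrakk> \<Longrightarrow> r \<otimes> x \<in> I"
  shows "ideal I R"
proof (rule idealI[OF ring_axioms])
  show "subgroup I (add_monoid R)"
  proof
    fix x assume "x \<in> I"
    then have "\<ominus> x = (\<ominus> \<one>) \<otimes> x" using sub by (auto simp: l_minus)
    then have "\<ominus> x \<in> I" using mult[of "\<ominus> \<one>" x] \<open>x \<in> I\<close> by simp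
    then show "inv\<^bsub>add_monoid R\<^esub> x \<in> I" by (simp add: a_inv_def)
  qed (use assms in auto)
  fix x r assume "x \<in> I" "r \<in> carrier R"
  then show "r \<otimes> x \<in> I" "x \<otimes> r \<in> I" using mult[of r x] sub m_comm[of x r] by auto
qed

lemma colon_ideal:
  assumes "ideal I R" "a \<in> carrier R"
  shows "ideal (colon I a) R"
proof (rule cring_idealI)
  interpret I: ideal I R by fact
  show "\<zero> \<in> colon I a" using assms(2) by (simp add: colon_def)
  show "x \<oplus> y \<in> colon I a" if "x \<in> colon I a" "y \<in> colon I a" for x y
    using that assms(2) by (simp add: colon_def l_distr)
  show "r \<otimes> x \<in> colon I a" if "r \<in> carrier R" "x \<in> colon I a" for r x
    using that assms(2) I.I_l_closed[of "x \<otimes> a" r] by (simp add: colon_def m_assoc)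
qed (auto simp: colon_def)

lemma dilate_ideal:
  assumes "ideal I R" "a \<in> carrier R"
  shows "ideal (dilate a I) R"
proof (rule cring_idealI)
  interpret I: ideal I R by fact
  show "dilate a I \<subseteq> carrier R" using assms(2) by (auto simp: dilate_def)
  show "\<zero> \<in> dilate a I"
    using assms(2) I.zero_closed by (auto simp: dilate_def intro!: exI[of _ \<zero>])
  show "x \<oplus> y \<in> dilate a I" if xy: "x \<in> dilate a I" "y \<in> dilate a I" for x y
  proof -
    from xy obtain r s where "r \<in> I" "s \<in> I" "x = a \<otimes> r" "y = a \<otimes> s"
      by (auto simp: dilate_def)
    then have "x \<oplus> y = a \<otimes> (r \<oplus> s)" "r \<oplus> s \<in> I" using assms(2) by (auto simp: r_distr)
    then show ?thesis by (auto simp: dilate_def)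
  qed
  show "r \<otimes> x \<in> dilate a I" if r: "r \<in> carrier R" and x: "x \<in> dilate a I" for r x
  proof -
    from x obtain s where "s \<in> I" "x = a \<otimes> s" by (auto simp: dilate_def)
    then have "r \<otimes> x = a \<otimes> (r \<otimes> s)" "r \<otimes> s \<in> I"
      using r assms(2) I.I_l_closed[of s r] by (auto simp: m_lcomm)
    then show ?thesis by (auto simp: dilate_def)
  qed
qed

lemma mem_cgenideal: "x \<in> PIdl a \<longleftrightarrow> (\<exists>r\<in>carrier R. x = r \<otimes> a)"
  by (auto simp: cgenideal_def)

lemma subset_colon: "ideal I R \<Longrightarrow> a \<in> carrier R \<Longrightarrow> I \<subseteq> colon I a"
  by (auto simp: colon_def ideal.Icarr ideal.I_r_closed)

text \<open>The quotient \<open>(N + aR) / N\<close> is cyclic with annihilator \<open>(N : a)\<close>, so its submodules correspond to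
the ideals above \<open>(N : a)\<close>.\<close>

lemma length_le_colon:
  assumes N: "ideal N R" and a: "a \<in> carrier R"
    and len: "length_le (colon N a) (carrier R) n"
  shows "length_le N (N <+>\<^bsub>R\<^esub> PIdl a) n"
proof (rule length_leI)
  fix c :: "nat \<Rightarrow> 'a set" and k
  assume c: "\<And>i. ideal (c i) R" "\<And>i. N \<subseteq> c i" "\<And>i. c i \<subseteq> N <+>\<^bsub>R\<^esub> PIdl a" "mono c"
  let ?D = "\<lambda>d :: nat \<Rightarrow> 'a set. {i. i < k \<and> d i \<noteq> d (Suc i)}"
  have "card (?D (\<lambda>i. colon (c i) a)) \<le> n"
  proof (rule length_leD[OF len])
    show "mono (\<lambda>i. colon (c i) a)"
      using monoD[OF c(4)] by (intro monoI) (auto simp: colon_def)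
    show "ideal (colon (c i) a) R" "colon N a \<subseteq> colon (c i) a" "colon (c i) a \<subseteq> carrier R" for i
      using c(2)[of i] colon_ideal[OF c(1) a] by (auto simp: colon_def)
  qed
  moreover have "?D c \<subseteq> ?D (\<lambda>i. colon (c i) a)"
  proof clarsimp
    fix i assume ne: "c i \<noteq> c (Suc i)" and eq: "colon (c i) a = colon (c (Suc i)) a"
    have sub: "c i \<subseteq> c (Suc i)" using monoD[OF c(4), of i "Suc i"] by simp
    have "c (Suc i) \<subseteq> c i"
    proof
      fix x assume x: "x \<in> c (Suc i)"
      then have "x \<in> N <+>\<^bsub>R\<^esub> PIdl a" using c(3) by blast
      then obtain y r where y: "y \<in> N" "r \<in> carrier R" "x = y \<oplus> r \<otimes> a"
        by (auto elim!: set_addE simp: mem_cgenideal)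
      have yc: "y \<in> carrier R" using y N ideal.Icarr by fast
      have "r \<otimes> a \<in> c (Suc i)"
        using set_add_diff[OF c(1)[of "Suc i"], of "r \<otimes> a" y] x y c(2)[of "Suc i"] a yc
        by (auto simp: a_comm)
      then have "r \<in> colon (c i) a" using eq y(2) by (simp add: colon_def)
      then show "x \<in> c i" using y c(1,2)[of i]
        by (auto simp: colon_def intro!: additive_subgroup.a_closed ideal.axioms(1))
    qed
    with sub ne show False by blast
  qed
  then have "card (?D c) \<le> card (?D (\<lambda>i. colon (c i) a))" by (intro card_mono) auto
  ultimately show "card (?D c) \<le> n" by linarith
qed

end

section \<open>Noetherian induction on ideals\<close>

context noetherian_domain begin

lemma ideal_maximal_member:
  assumes "F \<subseteq> {I. ideal I R}" "F \<noteq> {}"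
  obtains I where "I \<in> F" "\<And>J. J \<in> F \<Longrightarrow> I \<subseteq> J \<Longrightarrow> J = I"
proof -
  have "\<exists>I\<in>F. \<forall>J\<in>F. I \<subseteq> J \<longrightarrow> J = I"
  proof (rule subset_Zorn_nonempty[OF assms(2)])
    fix C assume C: "C \<noteq> {}" "subset.chain F C"
    then have "subset.chain {I. ideal I R} C" using assms(1) by (auto simp: pred_on.chain_def)
    from ideal_chain_is_trivial[OF C(1) this] show "\<Union>C \<in> F"
      using C(2) by (auto simp: pred_on.chain_def)
  qed
  then show thesis using that by blast
qed

text \<open>An ideal that is maximal among the counterexamples is neither the whole ring nor prime; a pair
\<open>a\<close>, \<open>b\<close> witnessing that it is not prime makes both \<open>J + aR\<close> and \<open>(J : a)\<close> strictly larger.\<close>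

lemma ideal_devissage [consumes 1, case_names carrier prime step]:
  assumes I: "ideal I R"
    and carrier: "Q (carrier R)"
    and prime: "\<And>J. \<lbrakk>primeideal J R; I \<subseteq> J\<rbrakk> \<Longrightarrow> Q J"
    and step: "\<And>J a. \<lbrakk>ideal J R; I \<subseteq> J; a \<in> carrier R; Q (J <+>\<^bsub>R\<^esub> PIdl a); Q (colon J a)\<rbrakk> \<Longrightarrow> Q J"
  shows "Q I"
proof (rule ccontr)
  assume "\<not> Q I"
  then have ne: "{J. ideal J R \<and> I \<subseteq> J \<and> \<not> Q J} \<noteq> {}" using I by blast
  obtain J where "J \<in> {J. ideal J R \<and> I \<subseteq> J \<and> \<not> Q J}"
    and max0: "\<And>K. \<lbrakk>K \<in> {J. ideal J R \<and> I \<subseteq> J \<and> \<not> Q J}; J \<subseteq> K\<rbrakk> \<Longrightarrow> K = J"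
    using ideal_maximal_member[OF _ ne] by blast
  then have J: "ideal J R" "I \<subseteq> J" "\<not> Q J" by auto
  have max: "K = J" if "ideal K R" "I \<subseteq> K" "\<not> Q K" "J \<subseteq> K" for K
    using max0 that by simp
  have "J \<noteq> carrier R" using J(3) carrier by blast
  moreover have "\<not> primeideal J R" using J prime by blast
  ultimately obtain a b where ab: "a \<in> carrier R" "b \<in> carrier R" "a \<otimes> b \<in> J" "a \<notin> J" "b \<notin> J"
    using ideal.primeidealCD[OF J(1) is_cring] by blast
  have Pa: "ideal (PIdl a) R" using ab cgenideal_ideal by blast
  have "Q (J <+>\<^bsub>R\<^esub> PIdl a)"
  proof (rule ccontr)
    assume "\<not> Q (J <+>\<^bsub>R\<^esub> PIdl a)"
    then have "J <+>\<^bsub>R\<^esub> PIdl a = J"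
      using max[OF add_ideals[OF J(1) Pa]] set_add_upper1[OF J(1) Pa] J(2) by blast
    then show False using set_add_upper2[OF J(1) Pa] cgenideal_self[OF ab(1)] ab(4) by blast
  qed
  moreover have "Q (colon J a)"
  proof (rule ccontr)
    assume "\<not> Q (colon J a)"
    then have "colon J a = J"
      using max[OF colon_ideal[OF J(1) ab(1)]] subset_colon[OF J(1) ab(1)] J(2) by blast
    moreover have "b \<in> colon J a" using ab m_comm[of b a] by (simp add: colon_def)
    ultimately show False using ab(5) by blast
  qed
  ultimately show False using step[OF J(1,2) ab(1)] J(3) by blast
qed

end

section \<open>Powers of ideals and homogeneous integral equations\<close>

context cring begin

abbreviation ideal_pow :: "'a set \<Rightarrow> nat \<Rightarrow> 'a set"
  where "ideal_pow I n \<equiv> I [^]\<^bsub>ideals_set R\<^esub> n"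

lemma ideal_pow_ideal: "ideal I R \<Longrightarrow> ideal (ideal_pow I n) R"
  using comm_monoid.axioms(1)[OF ideals_set_is_comm_monoid, THEN monoid.nat_pow_closed, of I n]
  by (simp add: ideals_set_def)

lemma ideal_pow_0: "ideal_pow I 0 = carrier R"
  using monoid.nat_pow_0[OF comm_monoid.axioms(1)[OF ideals_set_is_comm_monoid]]
  by (simp add: ideals_set_def)

lemma ideal_pow_Suc: "ideal_pow I (Suc n) = ideal_prod R (ideal_pow I n) I"
  using monoid.nat_pow_Suc[OF comm_monoid.axioms(1)[OF ideals_set_is_comm_monoid]]
  by (simp add: ideals_set_def)

lemma ideal_pow_add:
  "ideal I R \<Longrightarrow> ideal_pow I (m + n) = ideal_prod R (ideal_pow I m) (ideal_pow I n)"
  using monoid.nat_pow_mult[OF comm_monoid.axioms(1)[OF ideals_set_is_comm_monoid], of I m n]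
  by (simp add: ideals_set_def)

lemma ideal_pow_Suc_subset: "ideal I R \<Longrightarrow> ideal_pow I (Suc n) \<subseteq> ideal_pow I n"
  using ideal_prod_inter[OF ideal_pow_ideal] unfolding ideal_pow_Suc by blast

lemma pow_mem_ideal_pow:
  assumes "ideal I R" "t \<in> I"
  shows "t [^] n \<in> ideal_pow I n"
proof (induction n)
  case 0
  show ?case unfolding ideal_pow_0 by simp
next
  case (Suc n)
  then show ?case unfolding ideal_pow_Suc nat_pow_Suc using assms(2) by (rule ideal_prod.prod)
qed

lemma ideal_prod_least:
  assumes "ideal K R" "\<And>i j. i \<in> I \<Longrightarrow> j \<in> J \<Longrightarrow> i \<otimes> j \<in> K"
  shows "ideal_prod R I J \<subseteq> K"
proof
  fix s assume "s \<in> ideal_prod R I J"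
  then show "s \<in> K"
    by induction (use assms in \<open>auto intro: additive_subgroup.a_closed ideal.axioms(1)\<close>)
qed

text \<open>The ideal generated by the first \<open>j\<close> monomials of degree \<open>n\<close> in \<open>x\<close> and \<open>b\<close>, ordered by the exponent
of \<open>x\<close>. In a domain, \<open>x\<^sup>k \<in> forms x b k k\<close> is a monic equation of degree \<open>k\<close> for the fraction \<open>x / b\<close> with
the denominators cleared, so integrality of a fraction can be expressed inside the ring itself.\<close>

definition forms :: "'a \<Rightarrow> 'a \<Rightarrow> nat \<Rightarrow> nat \<Rightarrow> 'a set"
  where "forms x b n j = Idl ((\<lambda>i. x [^] i \<otimes> b [^] (n - i)) ` {..<j})"

lemma forms_ideal: "x \<in> carrier R \<Longrightarrow> b \<in> carrier R \<Longrightarrow> ideal (forms x b n j) R"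
  unfolding forms_def by (rule genideal_ideal) auto

lemma forms_gen:
  "x \<in> carrier R \<Longrightarrow> b \<in> carrier R \<Longrightarrow> i < j \<Longrightarrow> x [^] i \<otimes> b [^] (n - i) \<in> forms x b n j"
  unfolding forms_def
  by (rule genideal_self[THEN subsetD]) auto

lemma forms_least:
  "ideal J R \<Longrightarrow> (\<And>i. i < j \<Longrightarrow> x [^] i \<otimes> b [^] (n - i) \<in> J) \<Longrightarrow> forms x b n j \<subseteq> J"
  unfolding forms_def by (rule genideal_minimal) auto

lemma forms_mono:
  "x \<in> carrier R \<Longrightarrow> b \<in> carrier R \<Longrightarrow> i \<le> j \<Longrightarrow> forms x b n i \<subseteq> forms x b n j"
  by (rule forms_least) (auto intro: forms_ideal forms_gen)

text \<open>Multiplying a monic equation of \<open>x / b\<close> by \<open>x / b\<close> gives one of the next degree.\<close>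

lemma forms_Suc_degree:
  assumes "x \<in> carrier R" "b \<in> carrier R" "x [^] k \<in> forms x b k k"
  shows "x [^] Suc k \<in> forms x b (Suc k) (Suc k)"
proof -
  have "forms x b k k \<subseteq> colon (forms x b (Suc k) (Suc k)) x"
  proof (rule forms_least)
    show "ideal (colon (forms x b (Suc k) (Suc k)) x) R"
      using assms by (intro colon_ideal forms_ideal)
    fix i assume "i < k"
    have "x [^] i \<otimes> b [^] (k - i) \<otimes> x = x [^] Suc i \<otimes> b [^] (Suc k - Suc i)"
      using assms by (simp add: m_ac)
    then show "x [^] i \<otimes> b [^] (k - i) \<in> colon (forms x b (Suc k) (Suc k)) x"
      using assms forms_gen[of x b "Suc i" "Suc k" "Suc k"] \<open>i < k\<close> by (simp add: colon_def)
  qed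
  then show ?thesis using assms by (auto simp: colon_def)
qed

lemma forms_degree_mono:
  assumes "x \<in> carrier R" "b \<in> carrier R" "x [^] k \<in> forms x b k k" "k \<le> n"
  shows "x [^] n \<in> forms x b n n"
  using assms(4)
proof (induction rule: dec_induct)
  case base
  then show ?case by (rule assms(3))
next
  case (step n)
  then show ?case using forms_Suc_degree assms(1,2) by blast
qed

end

lemma (in domain) nat_pow_nonzero:
  assumes "x \<in> carrier R" "x \<noteq> \<zero>"
  shows "x [^] (n::nat) \<noteq> \<zero>"
  by (induction n) (use assms integral[of "x [^] _" x] in auto)

section \<open>Uniform degree bound in one-dimensional local domains\<close>

text \<open>Noetherian local domains of dimension at most one: a field satisfies the second assumption
vacuously.\<close>

locale one_dim_local_domain = noetherian_domain R for R (structure) +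
  fixes M :: "'a set"
  assumes maximal: "maximalideal M R"
    and one_dim: "\<lbrakk>primeideal J R; J \<noteq> {\<zero>}\<rbrakk> \<Longrightarrow> J = M"
begin

sublocale M: maximalideal M R by (rule maximal)

lemma nonzero_ideal_finite_colength:
  assumes I: "ideal I R" and "I \<noteq> {\<zero>}"
  shows "\<exists>n. length_le I (carrier R) n"
  using I
proof (induction rule: ideal_devissage)
  case carrier
  have "length_le (carrier R) (carrier R) 0"
  proof (rule length_leI)
    fix c :: "nat \<Rightarrow> 'a set" and k
    assume "\<And>i. carrier R \<subseteq> c i" "\<And>i. c i \<subseteq> carrier R"
    then have "c i = carrier R" for i by blast
    then show "card {i. i < k \<and> c i \<noteq> c (Suc i)} \<le> 0" by simp
  qed
  then show ?case by blast
next
  case (prime J)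
  then have "J \<noteq> {\<zero>}"
    using assms additive_subgroup.zero_closed[OF ideal.axioms(1)[OF I]] by blast
  then have J: "J = M" using one_dim prime by blast
  have "length_le M (carrier R) 1"
  proof (rule length_leI)
    fix c :: "nat \<Rightarrow> 'a set" and k
    assume c: "\<And>i. ideal (c i) R" "\<And>i. M \<subseteq> c i" "\<And>i. c i \<subseteq> carrier R" "mono c"
    have two: "c i = M \<or> c i = carrier R" for i
      using M.I_maximal[OF c(1) c(2) c(3)] by blast
    have "i = j" if ij: "c i \<noteq> c (Suc i)" "c j \<noteq> c (Suc j)" for i j
    proof -
      have *: "c i = M \<and> c (Suc i) = carrier R" if "c i \<noteq> c (Suc i)" for i
        using that two[of i] two[of "Suc i"] c(3)[of "Suc i"] monoD[OF c(4), of i "Suc i"]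
        by auto
      have **: "\<not> Suc i \<le> j" if "c i \<noteq> c (Suc i)" "c j \<noteq> c (Suc j)" for i j
        using *[OF that(1)] *[OF that(2)] monoD[OF c(4), of "Suc i" j] M.I_notcarr M.a_subset
        by auto
      show ?thesis using **[OF ij] **[OF ij(2,1)] by linarith
    qed
    then have "\<forall>i\<in>{i. i < k \<and> c i \<noteq> c (Suc i)}. \<forall>j\<in>{i. i < k \<and> c i \<noteq> c (Suc i)}. i = j"
      by blast
    then show "card {i. i < k \<and> c i \<noteq> c (Suc i)} \<le> 1"
      by (simp add: card_le_Suc0_iff_eq)
  qed
  then show ?case using J by blast
next
  case (step J a)
  then obtain m n where mn: "length_le (J <+>\<^bsub>R\<^esub> PIdl a) (carrier R) m"
    "length_le (colon J a) (carrier R) n" by blast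
  have Pa: "ideal (PIdl a) R" using step cgenideal_ideal by blast
  have "length_le J (carrier R) (n + m)"
    using length_le_add[OF add_ideals[OF step(1) Pa] set_add_upper1[OF step(1) Pa] _ oneideal
        length_le_colon[OF step(1,3) mn(2)] mn(1)] add_ideals[OF step(1) Pa] ideal_subset by blast
  then show ?case by blast
qed

lemma nonzero_ideal_contains_power:
  assumes I: "ideal I R" and "I \<noteq> {\<zero>}"
  shows "\<exists>n. ideal_pow M n \<subseteq> I"
  using I
proof (induction rule: ideal_devissage)
  case carrier
  show ?case using ideal_pow_0 by blast
next
  case (prime J)
  then have "J \<noteq> {\<zero>}"
    using assms additive_subgroup.zero_closed[OF ideal.axioms(1)[OF I]] by blast
  then have "J = M" using one_dim prime by blast
  moreover have "ideal_pow M (Suc 0) \<subseteq> M"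
    using ideal_prod_inter[OF oneideal M.is_ideal] unfolding ideal_pow_Suc ideal_pow_0 by blast
  ultimately show ?case by blast
next
  case (step J a)
  then obtain m n where mn: "ideal_pow M m \<subseteq> J <+>\<^bsub>R\<^esub> PIdl a" "ideal_pow M n \<subseteq> colon J a"
    by blast
  have "ideal_pow M (m + n) \<subseteq> J"
    unfolding ideal_pow_add[OF M.is_ideal]
  proof (rule ideal_prod_least[OF step(1)])
    interpret J: ideal J R by (rule step(1))
    fix i j assume "i \<in> ideal_pow M m" "j \<in> ideal_pow M n"
    then have "i \<in> J <+>\<^bsub>R\<^esub> PIdl a" and j: "j \<in> carrier R" "j \<otimes> a \<in> J"
      using mn by (auto simp: colon_def)
    then obtain y r where y: "y \<in> J" "r \<in> carrier R" "i = y \<oplus> r \<otimes> a"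
      by (auto elim!: set_addE simp: mem_cgenideal)
    then have "i \<otimes> j = y \<otimes> j \<oplus> r \<otimes> (j \<otimes> a)" using j(1) step(3) J.Icarr[OF y(1)] by algebra
    then show "i \<otimes> j \<in> J" using y j by (simp add: J.I_r_closed J.I_l_closed)
  qed
  then show ?case by blast
qed

text \<open>Comparing the two chains \<open>tI \<subseteq> tR \<subseteq> R\<close> and \<open>tI \<subseteq> I \<subseteq> R\<close>: since \<open>tR / tI\<close> and \<open>R / I\<close> are isomorphic
and of finite length, \<open>I / tI\<close> is no longer than \<open>R / tR\<close>. What matters is that the bound does not
depend on \<open>I\<close>.\<close>

lemma length_le_dilate:
  assumes I: "ideal I R" "I \<noteq> {\<zero>}" and t: "t \<in> carrier R" "t \<noteq> \<zero>"
    and e: "length_le (PIdl t) (carrier R) e"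
  shows "length_le (dilate t I) I e"
proof -
  interpret I: ideal I R by (rule I(1))
  obtain n where "length_le I (carrier R) n"
    using nonzero_ideal_finite_colength[OF I] by blast
  then obtain m where m: "length_le I (carrier R) m"
    and exact: "\<And>N e. \<lbrakk>N \<subseteq> I; length_le N (carrier R) (e + m)\<rbrakk> \<Longrightarrow> length_le N I e"
    using length_le_exact[OF I(1) ideal_subset[OF I(1)] oneideal] by blast
  have Pt: "ideal (PIdl t) R" using t cgenideal_ideal by blast
  have tI: "ideal (dilate t I) R" using dilate_ideal I t by blast
  have "dilate t I \<subseteq> PIdl t"
    using t by (auto simp: dilate_def mem_cgenideal m_comm intro!: bexI[OF _ I.Icarr])
  then have sum: "dilate t I <+>\<^bsub>R\<^esub> PIdl t = PIdl t"
    using set_add_least[OF Pt] set_add_upper2[OF tI Pt] by blast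
  have "colon (dilate t I) t = I"
  proof
    show "I \<subseteq> colon (dilate t I) t"
    proof
      fix x assume x: "x \<in> I"
      then have "x \<otimes> t = t \<otimes> x" using t I.Icarr m_comm by blast
      then show "x \<in> colon (dilate t I) t" using x I.Icarr by (auto simp: dilate_def colon_def)
    qed
    show "colon (dilate t I) t \<subseteq> I"
    proof
      fix x assume "x \<in> colon (dilate t I) t"
      then obtain r where "x \<in> carrier R" "r \<in> I" "t \<otimes> x = t \<otimes> r"
        using t by (auto simp: dilate_def colon_def m_comm)
      then show "x \<in> I" using t I.Icarr m_lcancel[of t x r] by auto
    qed
  qed
  then have "length_le (dilate t I) (PIdl t) m"
    using length_le_colon[OF tI t(1), of m] m sum by simp
  then have "length_le (dilate t I) (carrier R) (m + e)"
    using length_le_add[OF Pt \<open>dilate t I \<subseteq> PIdl t\<close> ideal_subset[OF Pt] oneideal _ e] by blast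
  moreover have "dilate t I \<subseteq> I" using t I.I_l_closed by (auto simp: dilate_def)
  ultimately show ?thesis using exact by (simp add: add.commute)
qed

text \<open>All integral fractions satisfy monic equations of one and the same degree. If \<open>x / b\<close> is
integral, then for large \<open>n\<close> the ideal \<open>I = (x, b)\<^sup>n\<close> satisfies \<open>xI \<subseteq> bI\<close>; it is a copy of the finite
algebra generated by \<open>x / b\<close>, with the monomials \<open>g i = x\<^sup>i b\<^sup>n\<^sup>-\<^sup>i\<close> in the role of the powers of \<open>x / b\<close>. Because
\<open>I / tI\<close> has length at most \<open>e\<close>, one of \<open>g 1, \<dots>, g (e + 1)\<close> is, modulo \<open>tI\<close>, a combination of its
predecessors. Such a relation propagates to all later monomials, and the error term in \<open>tI\<close> is then
removed by iteration, since a power of \<open>t\<close> lies in the ideal generated by the predecessors.\<close>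

lemma uniform_degree_bound:
  assumes t: "t \<in> M" "t \<noteq> \<zero>" and e: "length_le (PIdl t) (carrier R) e"
    and x: "x \<in> carrier R" and b: "b \<in> carrier R" "b \<noteq> \<zero>"
    and int: "x [^] k \<in> forms x b k k"
  shows "x [^] Suc e \<in> forms x b (Suc e) (Suc e)"
proof -
  have tc: "t \<in> carrier R" using t M.Icarr by blast
  define n where "n = k + Suc e"
  have int': "x [^] Suc n \<in> forms x b (Suc n) (Suc n)"
    by (rule forms_degree_mono[OF x b(1) int]) (simp add: n_def)
  define I where "I = forms x b n (Suc n)"
  define g where "g = (\<lambda>i. x [^] i \<otimes> b [^] (n - i))"
  have gc: "g i \<in> carrier R" for i using x b by (simp add: g_def)
  have I: "ideal I R" unfolding I_def using x b forms_ideal by blast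
  have gI: "g i \<in> I" if "i \<le> n" for i
    unfolding g_def I_def using that x b forms_gen by simp
  have bpow: "b [^] i \<noteq> \<zero>" for i :: nat
    using nat_pow_nonzero b by blast
  have I0: "I \<noteq> {\<zero>}" using gI[of 0] bpow b by (auto simp: g_def)
  define tI where "tI = dilate t I"
  have tI: "ideal tI R" unfolding tI_def using dilate_ideal I tc by blast
  \<comment> \<open>The forms of degree \<open>n\<close> satisfy \<open>x I \<subseteq> b I\<close>.\<close>
  have xg: "x \<otimes> g i = b \<otimes> g (Suc i)" if "i < n" for i
  proof -
    have "n - i = Suc (n - Suc i)" using that by simp
    then show ?thesis using x b by (simp add: g_def m_ac)
  qed
  have xg': "x \<otimes> g i \<in> dilate b I" if "i \<le> n" for i
  proof (cases "i = n")
    case False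
    then show ?thesis using xg[of i] gI[of "Suc i"] that by (auto simp: dilate_def)
  next
    case True
    have "forms x b (Suc n) (Suc n) \<subseteq> dilate b I"
    proof (rule forms_least)
      show "ideal (dilate b I) R" using dilate_ideal I b by blast
      fix i assume "i < Suc n"
      then have "x [^] i \<otimes> b [^] (Suc n - i) = b \<otimes> g i"
        using x b by (simp add: g_def m_ac Suc_diff_le)
      then show "x [^] i \<otimes> b [^] (Suc n - i) \<in> dilate b I"
        using gI[of i] \<open>i < Suc n\<close> by (auto simp: dilate_def)
    qed
    then show ?thesis using int' True x by (auto simp: g_def m_ac)
  qed
  have xI: "x \<otimes> y \<in> dilate b I" if "y \<in> I" for y
  proof -
    have "I \<subseteq> colon (dilate b I) x"
      unfolding I_def
    proof (rule forms_least, fold I_def)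
      show "ideal (colon (dilate b I) x) R" using colon_ideal dilate_ideal I x b by blast
      fix i assume "i < Suc n"
      then have "g i \<in> colon (dilate b I) x"
        using xg'[of i] x gc[of i] m_comm[of x "g i"] by (simp add: colon_def)
      then show "x [^] i \<otimes> b [^] (n - i) \<in> colon (dilate b I) x" by (simp add: g_def)
    qed
    then have "y \<otimes> x \<in> dilate b I" using that by (auto simp: colon_def)
    moreover have "y \<otimes> x = x \<otimes> y" using that x ideal.Icarr[OF I] m_comm by blast
    ultimately show ?thesis by simp
  qed
  \<comment> \<open>Some generator is redundant modulo \<open>t I\<close>. The chain starts with the monomial \<open>g 0\<close> already
      included, so that the ideal \<open>N j\<close> found below is nonzero; this accounts for the degree
      \<open>Suc e\<close> in place of \<open>e\<close>.\<close>
  define N where "N = (\<lambda>j. forms x b n j)"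
  have N: "ideal (N j) R" for j unfolding N_def using x b forms_ideal by blast
  define c where "c = (\<lambda>i. N (Suc (min i (Suc e))) <+>\<^bsub>R\<^esub> tI)"
  have tI_I: "tI \<subseteq> I" unfolding tI_def dilate_def using ideal.I_l_closed[OF I _ tc] by blast
  have "card {i. i < Suc e \<and> c i \<noteq> c (Suc i)} \<le> e"
  proof (rule length_leD[OF length_le_dilate[OF I I0 tc t(2) e]])
    show "ideal (c i) R" for i unfolding c_def using N tI add_ideals by blast
    show "dilate t I \<subseteq> c i" for i unfolding c_def using N tI set_add_upper2 tI_def by blast
    show "c i \<subseteq> I" for i unfolding c_def
    proof (rule set_add_least[OF I _ tI_I])
      show "N (Suc (min i (Suc e))) \<subseteq> I"
        unfolding N_def I_def by (rule forms_mono[OF x b(1)]) (simp add: n_def)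
    qed
    show "mono c" unfolding c_def N_def
      by (intro monoI set_add_mono order_refl forms_mono x b) (simp add: min_le_iff_disj)
  qed
  then have "{i. i < Suc e \<and> c i \<noteq> c (Suc i)} \<noteq> {..<Suc e}" by (metis card_lessThan not_less_eq_eq order_refl)
  then obtain i where i: "i \<le> e" "c i = c (Suc i)"
    using less_Suc_eq_le by auto
  define j where "j = Suc i"
  have j: "1 \<le> j" "j \<le> Suc e" "j \<le> n" using i by (auto simp: j_def n_def)
  define N' where "N' = N j <+>\<^bsub>R\<^esub> tI"
  have N': "ideal N' R" unfolding N'_def using N tI add_ideals by blast
  have gl: "g l \<in> N'" if "l \<le> j" for l
  proof -
    have "g l \<in> N (Suc j)" unfolding N_def g_def using x b forms_gen that by simp
    then have "g l \<in> c (Suc i)"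
      using set_add_upper1[OF N tI, of "Suc j"] i by (auto simp: c_def j_def)
    then show ?thesis using i by (simp add: N'_def c_def j_def)
  qed
  \<comment> \<open>Then so are all later ones, because \<open>N'\<close> is stable under multiplication by \<open>x / b\<close>.\<close>
  have stable: "N' \<subseteq> colon (dilate b N') x"
    unfolding N'_def
  proof (rule set_add_least, fold N'_def)
    show id: "ideal (colon (dilate b N') x) R"
      using x b N' colon_ideal dilate_ideal by blast
    show "N j \<subseteq> colon (dilate b N') x"
      unfolding N_def
    proof (rule forms_least[OF id])
      fix l assume l: "l < j"
      have "x \<otimes> g l \<in> dilate b N'" using xg[of l] gl[of "Suc l"] l j by (auto simp: dilate_def)
      then have "g l \<in> colon (dilate b N') x"
        using x gc[of l] m_comm[of x "g l"] by (simp add: colon_def)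
      then show "x [^] l \<otimes> b [^] (n - l) \<in> colon (dilate b N') x" by (simp add: g_def)
    qed
    show "tI \<subseteq> colon (dilate b N') x"
    proof
      fix z assume "z \<in> tI"
      then obtain y where y: "y \<in> I" "z = t \<otimes> y" by (auto simp: tI_def dilate_def)
      obtain y' where y': "y' \<in> I" "x \<otimes> y = b \<otimes> y'" using xI[OF y(1)] by (auto simp: dilate_def)
      have yc: "y \<in> carrier R" "y' \<in> carrier R" using y y' I ideal.Icarr by fast+
      have "z \<otimes> x = t \<otimes> (x \<otimes> y)" using y yc x tc by (simp add: m_ac)
      also have "\<dots> = b \<otimes> (t \<otimes> y')" using y' yc b tc by (simp add: m_ac)
      finally have "z \<otimes> x = b \<otimes> (t \<otimes> y')" .
      moreover have "t \<otimes> y' \<in> N'"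
        using y'(1) set_add_upper2[OF N tI, of j] by (auto simp: N'_def tI_def dilate_def)
      ultimately show "z \<in> colon (dilate b N') x"
        using y yc tc by (auto simp: colon_def dilate_def)
    qed
  qed
  have gN': "g l \<in> N'" if "l \<le> n" for l
    using that
  proof (induction l)
    case 0
    then show ?case using gl by simp
  next
    case (Suc l)
    then have "g l \<in> colon (dilate b N') x" using stable by auto
    then have "x \<otimes> g l \<in> dilate b N'" using x gc[of l] m_comm[of x "g l"] by (simp add: colon_def)
    then obtain y where "y \<in> N'" "b \<otimes> g (Suc l) = b \<otimes> y"
      using xg[of l] Suc.prems by (auto simp: dilate_def)
    then show ?case using m_lcancel[of b "g (Suc l)" y] b gc ideal.Icarr[OF N'] by metis
  qed
  have IN': "I \<subseteq> N'"
    unfolding I_def by (rule forms_least[OF N']) (use gN' in \<open>simp add: g_def\<close>)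
  \<comment> \<open>Iterating \<open>I \<subseteq> N + t I\<close> replaces \<open>t\<close> by a power that multiplies \<open>I\<close> into \<open>N\<close>.\<close>
  have iterate: "I \<subseteq> N j <+>\<^bsub>R\<^esub> dilate (t [^] m) I" for m :: nat
  proof (induction m)
    case 0
    have "I \<subseteq> dilate (t [^] (0::nat)) I"
      using ideal.Icarr[OF I] by (force simp: dilate_def)
    then show ?case using set_add_upper2[OF N dilate_ideal[OF I]] tc by blast
  next
    case (Suc m)
    show ?case
    proof
      fix y assume "y \<in> I"
      then obtain p q where pq: "p \<in> N j" "q \<in> I" "y = p \<oplus> t [^] m \<otimes> q"
        using Suc by (force elim!: set_addE simp: dilate_def)
      obtain p' q' where pq': "p' \<in> N j" "q' \<in> I" "q = p' \<oplus> t \<otimes> q'"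
        using IN' pq(2) by (force elim!: set_addE simp: dilate_def N'_def tI_def)
      have cl: "p \<in> carrier R" "q \<in> carrier R" "p' \<in> carrier R" "q' \<in> carrier R"
        using pq pq' ideal.Icarr[OF I] ideal.Icarr[OF N] by blast+
      have "y = (p \<oplus> t [^] m \<otimes> p') \<oplus> t [^] Suc m \<otimes> q'"
        using pq(3) pq'(3) cl tc by (simp add: r_distr m_assoc a_assoc)
      moreover have "p \<oplus> t [^] m \<otimes> p' \<in> N j"
        using pq pq' tc ideal.I_l_closed[OF N] additive_subgroup.a_closed[OF ideal.axioms(1)[OF N]]
        by simp
      ultimately show "y \<in> N j <+>\<^bsub>R\<^esub> dilate (t [^] Suc m) I"
        using pq' by (auto simp: dilate_def intro!: set_addI)
    qed
  qed
  have "N j \<noteq> {\<zero>}"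
  proof -
    have "g 0 \<in> N j" unfolding N_def g_def using forms_gen[OF x b(1), of 0 j n] j by simp
    then show ?thesis using bpow b by (auto simp: g_def)
  qed
  then obtain m where m: "ideal_pow M m \<subseteq> N j"
    using nonzero_ideal_contains_power N by blast
  then have tm: "t [^] m \<in> N j" using pow_mem_ideal_pow[OF M.is_ideal t(1)] by blast
  have "dilate (t [^] m) I \<subseteq> N j"
    using ideal.I_r_closed[OF N tm] ideal.Icarr[OF I] by (auto simp: dilate_def)
  then have "I \<subseteq> N j" using iterate[of m] set_add_least[OF N order_refl] by blast
  then have gj: "g j \<in> N j" using gI j by blast
  have "N j \<subseteq> dilate (b [^] (n - j)) (forms x b j j)"
    unfolding N_def
  proof (rule forms_least)
    show "ideal (dilate (b [^] (n - j)) (forms x b j j)) R"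
      using x b by (intro dilate_ideal forms_ideal) auto
    fix l assume l: "l < j"
    have "x [^] l \<otimes> b [^] (n - l) = b [^] (n - j) \<otimes> (x [^] l \<otimes> b [^] (j - l))"
    proof -
      have "b [^] (n - l) = b [^] (n - j) \<otimes> b [^] (j - l)"
        using nat_pow_mult[OF b(1), of "n - j" "j - l"] l j by simp
      then show ?thesis using x b by (simp add: m_ac)
    qed
    then show "x [^] l \<otimes> b [^] (n - l) \<in> dilate (b [^] (n - j)) (forms x b j j)"
      using forms_gen[OF x b(1) l, of j] by (auto simp: dilate_def)
  qed
  then obtain y where y: "y \<in> forms x b j j" "g j = b [^] (n - j) \<otimes> y"
    using gj by (auto simp: dilate_def)
  then have "b [^] (n - j) \<otimes> x [^] j = b [^] (n - j) \<otimes> y" using x b by (simp add: g_def m_comm)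
  moreover have "y \<in> carrier R" by (rule ideal.Icarr[OF forms_ideal[OF x b(1)] y(1)])
  ultimately have "x [^] j = y" using m_lcancel[of "b [^] (n - j)" "x [^] j" y] bpow x b by simp
  then have "x [^] j \<in> forms x b j j" using y by simp
  then show ?thesis using forms_degree_mono[OF x b(1)] j by blast
qed

end

section \<open>Null sequences in a reduced completion\<close>

context cring begin

lemma completion_pow:
  assumes I: "ideal I R" and w: "\<And>n. w n \<in> carrier R"
  shows "(\<lambda>n. ideal_pow I n +> w n) [^]\<^bsub>adic_completion R I\<^esub> (k::nat)
       = (\<lambda>n. ideal_pow I n +> w n [^] k)"
proof (induction k)
  case 0
  have "f [^]\<^bsub>adic_completion R I\<^esub> (0::nat) = \<one>\<^bsub>adic_completion R I\<^esub>" for f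
    by (simp add: nat_pow_def)
  then show ?case by (simp add: adic_completion_def Let_def FactRing_def)
next
  case (Suc k)
  have "(\<lambda>n. ideal_pow I n +> w n) [^]\<^bsub>adic_completion R I\<^esub> (Suc k)
    = (\<lambda>n. ideal_pow I n +> w n [^] k) \<otimes>\<^bsub>adic_completion R I\<^esub> (\<lambda>n. ideal_pow I n +> w n)"
    using Suc by (simp add: nat_pow_def)
  also have "\<dots> = (\<lambda>n. ideal_pow I n +> w n [^] Suc k)"
    using ideal.rcoset_mult_add[OF ideal_pow_ideal[OF I]] w
    by (simp add: adic_completion_def Let_def FactRing_def)
  finally show ?case .
qed

text \<open>The sequence \<open>w\<close> defines an element of the completion, and the last hypothesis says that its
\<open>k\<close>-th power is zero.\<close>

lemma reduced_completion_null_sequence: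
  assumes I: "ideal I R" and red: "reduced_ring (adic_completion R I)"
    and w: "\<And>n. w n \<in> carrier R" and cauchy: "\<And>n. w (Suc n) \<ominus> w n \<in> ideal_pow I n"
    and pow: "\<And>n. w n [^] (k::nat) \<in> ideal_pow I n"
  shows "w n \<in> ideal_pow I n"
proof -
  let ?f = "\<lambda>n. ideal_pow I n +> w n"
  have "?f (Suc n) \<subseteq> ?f n" for n
  proof -
    have "?f (Suc n) \<subseteq> ideal_pow I n +> w (Suc n)"
      using ideal_pow_Suc_subset[OF I] by (auto simp: a_r_coset_def')
    also have "\<dots> = ?f n"
      using quotient_eq_iff_same_a_r_cos[OF ideal_pow_ideal[OF I] w w] cauchy by blast
    finally show ?thesis .
  qed
  moreover have "?f n \<in> carrier (R Quot ideal_pow I n)" for n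
    using a_rcosetsI[OF ideal_subset[OF ideal_pow_ideal[OF I]] w] by (simp add: FactRing_def)
  ultimately have f: "?f \<in> carrier (adic_completion R I)"
    by (simp add: adic_completion_def Let_def)
  have "?f [^]\<^bsub>adic_completion R I\<^esub> k = (\<lambda>n. ideal_pow I n)"
    unfolding completion_pow[OF I w]
    using pow ideal_pow_ideal[OF I] w
    by (intro ext a_coset_join2) (auto simp: additive_subgroup.a_subgroup ideal.axioms(1))
  also have "\<dots> = \<zero>\<^bsub>adic_completion R I\<^esub>"
    by (simp add: adic_completion_def Let_def FactRing_def)
  finally have "?f = \<zero>\<^bsub>adic_completion R I\<^esub>" using red f by (auto simp: reduced_ring_def)
  from fun_cong[OF this, of n] have "?f n = ideal_pow I n" by (simp add: adic_completion_def Let_def FactRing_def)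
  then show ?thesis using ideal.rcos_const_imp_mem[OF ideal_pow_ideal[OF I] w] by blast
qed

end

context one_dim_local_domain begin

text \<open>The recursion makes \<open>w\<close> a Cauchy sequence whose terms are all congruent modulo \<open>v\<close>. The integral
equation of \<open>w n / (v t\<^sup>n)\<close> shows that a power of \<open>w n\<close> lies in \<open>t\<^sup>n R\<close>, and by the uniform degree bound
the exponent does not depend on \<open>n\<close>. Hence the limit of \<open>w\<close> is nilpotent in the completion and
therefore zero. So \<open>w n\<close> lies in high powers of \<open>M\<close>, in particular in \<open>vR\<close> for large \<open>n\<close>.\<close>

theorem integral_division_mem:
  assumes red: "reduced_ring (adic_completion R M)"
    and t: "t \<in> M" "t \<noteq> \<zero>" and v: "v \<in> carrier R" "v \<noteq> \<zero>"
    and w: "\<And>n. w n \<in> carrier R" and a: "\<And>n. a n \<in> carrier R"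
    and step: "\<And>n. w (Suc n) = w n \<oplus> a n \<otimes> (v \<otimes> t [^] n)"
    and int: "\<And>n. \<exists>k. w n [^] k \<in> forms (w n) (v \<otimes> t [^] n) k k"
  shows "w 0 \<in> PIdl v"
proof -
  have tc: "t \<in> carrier R" using t M.Icarr by blast
  have Pv: "ideal (PIdl v) R" using v cgenideal_ideal by blast
  have Pt: "ideal (PIdl t) R" using tc cgenideal_ideal by blast
  have "PIdl t \<noteq> {\<zero>}" "PIdl v \<noteq> {\<zero>}"
    using cgenideal_self tc t v by blast+
  then obtain e where e: "length_le (PIdl t) (carrier R) e"
    using nonzero_ideal_finite_colength[OF Pt] by blast
  have tn: "r \<otimes> (v \<otimes> t [^] n) \<in> ideal_pow M n" if "r \<in> carrier R" for r n
    using ideal.I_l_closed[OF ideal_pow_ideal[OF M.is_ideal] pow_mem_ideal_pow[OF M.is_ideal t(1)],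
        of "r \<otimes> v" n] that v tc by (simp add: m_assoc)
  have pow: "w n [^] Suc e \<in> ideal_pow M n" for n
  proof -
    let ?b = "v \<otimes> t [^] n"
    have b: "?b \<in> carrier R" "?b \<noteq> \<zero>"
      using v tc t nat_pow_nonzero[of t n] integral[of v "t [^] n"] by auto
    obtain k where "w n [^] k \<in> forms (w n) ?b k k" using int by blast
    from uniform_degree_bound[OF t e w b this]
    have "w n [^] Suc e \<in> forms (w n) ?b (Suc e) (Suc e)" .
    moreover have "forms (w n) ?b (Suc e) (Suc e) \<subseteq> ideal_pow M n"
    proof (rule forms_least[OF ideal_pow_ideal[OF M.is_ideal]])
      fix i assume "i < Suc e"
      then have "Suc e - i = Suc (e - i)" by simp
      then have "w n [^] i \<otimes> ?b [^] (Suc e - i) = (w n [^] i \<otimes> ?b [^] (e - i)) \<otimes> ?b"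
        using w b by (simp add: m_assoc)
      then show "w n [^] i \<otimes> ?b [^] (Suc e - i) \<in> ideal_pow M n"
        using tn[of "w n [^] i \<otimes> ?b [^] (e - i)" n] w b by simp
    qed
    ultimately show ?thesis by blast
  qed
  have null: "w n \<in> ideal_pow M n" for n
  proof (rule reduced_completion_null_sequence[OF M.is_ideal red w _ pow])
    fix n
    have "w (Suc n) \<ominus> w n = a n \<otimes> (v \<otimes> t [^] n)"
      unfolding step using w[of n] a[of n] v tc nat_pow_closed[OF tc, of n] by algebra
    then show "w (Suc n) \<ominus> w n \<in> ideal_pow M n" using tn a by simp
  qed
  have cong: "w 0 \<in> PIdl v" if "w n \<in> PIdl v" for n
    using that
  proof (induction n)
    case (Suc n)
    have "a n \<otimes> (v \<otimes> t [^] n) \<in> PIdl v"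
      using v a[of n] tc by (auto simp: mem_cgenideal m_ac intro!: bexI[of _ "a n \<otimes> t [^] n"])
    then have "w n \<in> PIdl v"
      using set_add_diff[OF Pv] Suc.prems w unfolding step by blast
    then show ?case by (rule Suc.IH)
  qed
  obtain n where "ideal_pow M n \<subseteq> PIdl v"
    using nonzero_ideal_contains_power[OF Pv \<open>PIdl v \<noteq> {\<zero>}\<close>] by blast
  then show ?thesis using cong null by blast
qed

end

section \<open>Localization of a domain\<close>

locale domain_localization = domain R for R (structure) +
  fixes S :: "'a set"
  assumes sub: "S \<subseteq> carrier R - {\<zero>}"
    and one_mem: "\<one> \<in> S"
    and mult_mem: "\<lbrakk>s \<in> S; t \<in> S\<rbrakk> \<Longrightarrow> s \<otimes> t \<in> S"
begin

abbreviation L where "L \<equiv> localization R S"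
abbreviation frac where "frac \<equiv> loc_frac R S"
abbreviation emb where "emb a \<equiv> loc_frac R S a \<one>"

lemma carr: "s \<in> S \<Longrightarrow> s \<in> carrier R" and nz: "s \<in> S \<Longrightarrow> s \<noteq> \<zero>"
  using sub by auto

lemma mem_frac:
  assumes "a \<in> carrier R" "s \<in> S"
  shows "x \<in> frac a s \<longleftrightarrow> fst x \<in> carrier R \<and> snd x \<in> S \<and> snd x \<otimes> a = s \<otimes> fst x"
proof -
  have "snd x \<otimes> a = s \<otimes> fst x"
    if "u \<in> S" "fst x \<in> carrier R" "snd x \<in> S" "u \<otimes> (snd x \<otimes> a) = u \<otimes> (s \<otimes> fst x)" for u
    using that assms carr nz m_lcancel[of u "snd x \<otimes> a" "s \<otimes> fst x"] by simp
  then show ?thesis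
    unfolding loc_frac_def using one_mem by (cases x) auto
qed

lemma frac_self: "a \<in> carrier R \<Longrightarrow> s \<in> S \<Longrightarrow> (a, s) \<in> frac a s"
  by (simp add: mem_frac carr m_comm)

lemma frac_eqI:
  assumes "a \<in> carrier R" "s \<in> S" "b \<in> carrier R" "t \<in> S" and eq: "t \<otimes> a = s \<otimes> b"
  shows "frac a s = frac b t"
proof -
  have "frac a s \<subseteq> frac b t"
    if *: "a \<in> carrier R" "s \<in> S" "b \<in> carrier R" "t \<in> S" "t \<otimes> a = s \<otimes> b" for a s b t
  proof
    fix x assume "x \<in> frac a s"
    then have x: "fst x \<in> carrier R" "snd x \<in> S" "snd x \<otimes> a = s \<otimes> fst x"
      using mem_frac * by auto
    have "s \<otimes> (snd x \<otimes> b) = snd x \<otimes> (t \<otimes> a)" using * x carr by (simp add: m_ac)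
    also have "\<dots> = t \<otimes> (s \<otimes> fst x)" using * x carr m_lcomm[of "snd x" t a] by simp
    also have "\<dots> = s \<otimes> (t \<otimes> fst x)" using * x carr by (simp add: m_ac)
    finally have "snd x \<otimes> b = t \<otimes> fst x"
      using * x carr nz m_lcancel[of s "snd x \<otimes> b" "t \<otimes> fst x"] by simp
    then show "x \<in> frac b t" using x * mem_frac by simp
  qed
  from this[OF assms] this[OF assms(3,4,1,2) eq[symmetric]] show ?thesis by blast
qed

lemma frac_eq_iff:
  assumes "a \<in> carrier R" "s \<in> S" "b \<in> carrier R" "t \<in> S"
  shows "frac a s = frac b t \<longleftrightarrow> t \<otimes> a = s \<otimes> b"
  using frac_eqI[OF assms] frac_self[OF assms(3,4)] mem_frac[OF assms(1,2)] by auto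

lemma frac_closed [simp]: "a \<in> carrier R \<Longrightarrow> s \<in> S \<Longrightarrow> frac a s \<in> carrier L"
  by (auto simp: localization_def)

lemma frac_cases:
  assumes "x \<in> carrier L"
  obtains a s where "a \<in> carrier R" "s \<in> S" "x = frac a s"
  using assms by (auto simp: localization_def)

lemma frac_mult:
  assumes "a \<in> carrier R" "s \<in> S" "b \<in> carrier R" "t \<in> S"
  shows "frac a s \<otimes>\<^bsub>L\<^esub> frac b t = frac (a \<otimes> b) (s \<otimes> t)"
proof -
  have "frac (fst x \<otimes> fst y) (snd x \<otimes> snd y) = frac (a \<otimes> b) (s \<otimes> t)"
    if "x \<in> frac a s" "y \<in> frac b t" for x y
  proof -
    have x: "fst x \<in> carrier R" "snd x \<in> S" "snd x \<otimes> a = s \<otimes> fst x"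
      and y: "fst y \<in> carrier R" "snd y \<in> S" "snd y \<otimes> b = t \<otimes> fst y"
      using that mem_frac assms by auto
    have "(s \<otimes> t) \<otimes> (fst x \<otimes> fst y) = (s \<otimes> fst x) \<otimes> (t \<otimes> fst y)"
      using assms x(1,2) y(1,2) carr by (simp add: m_ac)
    also have "\<dots> = (snd x \<otimes> a) \<otimes> (snd y \<otimes> b)" using x y by simp
    also have "\<dots> = (snd x \<otimes> snd y) \<otimes> (a \<otimes> b)"
      using assms x(1,2) y(1,2) carr by (simp add: m_ac)
    finally show ?thesis using assms x y by (intro frac_eqI) (simp_all add: mult_mem)
  qed
  then show ?thesis
    using frac_self[OF assms(1,2)] frac_self[OF assms(3,4)]
    unfolding localization_def by simp blast
qed

lemma frac_add:
  assumes "a \<in> carrier R" "s \<in> S" "b \<in> carrier R" "t \<in> S"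
  shows "frac a s \<oplus>\<^bsub>L\<^esub> frac b t = frac (t \<otimes> a \<oplus> s \<otimes> b) (s \<otimes> t)"
proof -
  have "frac (snd y \<otimes> fst x \<oplus> snd x \<otimes> fst y) (snd x \<otimes> snd y) = frac (t \<otimes> a \<oplus> s \<otimes> b) (s \<otimes> t)"
    if "x \<in> frac a s" "y \<in> frac b t" for x y
  proof -
    have x: "fst x \<in> carrier R" "snd x \<in> S" "snd x \<otimes> a = s \<otimes> fst x"
      and y: "fst y \<in> carrier R" "snd y \<in> S" "snd y \<otimes> b = t \<otimes> fst y"
      using that mem_frac assms by auto
    have "(s \<otimes> t) \<otimes> (snd y \<otimes> fst x \<oplus> snd x \<otimes> fst y)
        = t \<otimes> snd y \<otimes> (s \<otimes> fst x) \<oplus> s \<otimes> snd x \<otimes> (t \<otimes> fst y)"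
      using assms x(1,2) y(1,2) carr by (simp add: m_ac r_distr)
    also have "\<dots> = t \<otimes> snd y \<otimes> (snd x \<otimes> a) \<oplus> s \<otimes> snd x \<otimes> (snd y \<otimes> b)" using x y by simp
    also have "\<dots> = (snd x \<otimes> snd y) \<otimes> (t \<otimes> a \<oplus> s \<otimes> b)"
      using assms x(1,2) y(1,2) carr by (simp add: m_ac r_distr)
    finally show ?thesis using assms x y carr by (intro frac_eqI) (simp_all add: mult_mem)
  qed
  then show ?thesis
    using frac_self[OF assms(1,2)] frac_self[OF assms(3,4)]
    unfolding localization_def by simp blast
qed

lemma L_one: "\<one>\<^bsub>L\<^esub> = emb \<one>" and L_zero: "\<zero>\<^bsub>L\<^esub> = emb \<zero>"
  by (simp_all add: localization_def)

lemmas frac_simps = frac_mult frac_add L_one L_zero carr mult_mem one_mem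

lemma L_domain: "domain L"
proof -
  have "cring L"
  proof (rule cringI)
    show "abelian_group L"
    proof (rule abelian_groupI)
      fix x y assume "x \<in> carrier L" "y \<in> carrier L"
      then obtain a s b t where xy: "a \<in> carrier R" "s \<in> S" "x = frac a s"
        "b \<in> carrier R" "t \<in> S" "y = frac b t" using frac_cases by metis
      show "x \<oplus>\<^bsub>L\<^esub> y \<in> carrier L" using xy by (simp add: frac_simps)
      show "x \<oplus>\<^bsub>L\<^esub> y = y \<oplus>\<^bsub>L\<^esub> x" using xy by (simp add: frac_simps a_comm m_comm)
      show "\<zero>\<^bsub>L\<^esub> \<oplus>\<^bsub>L\<^esub> x = x" using xy by (simp add: frac_simps)
      have "frac (\<ominus> a) s \<oplus>\<^bsub>L\<^esub> x = \<zero>\<^bsub>L\<^esub>"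
        using xy by (simp add: frac_simps r_minus l_neg frac_eq_iff)
      then show "\<exists>y\<in>carrier L. y \<oplus>\<^bsub>L\<^esub> x = \<zero>\<^bsub>L\<^esub>" using xy by (auto intro!: bexI)
    next
      fix x y z assume "x \<in> carrier L" "y \<in> carrier L" "z \<in> carrier L"
      then obtain a s b t c u where xy: "a \<in> carrier R" "s \<in> S" "x = frac a s"
        "b \<in> carrier R" "t \<in> S" "y = frac b t" "c \<in> carrier R" "u \<in> S" "z = frac c u"
        using frac_cases by metis
      show "x \<oplus>\<^bsub>L\<^esub> y \<oplus>\<^bsub>L\<^esub> z = x \<oplus>\<^bsub>L\<^esub> (y \<oplus>\<^bsub>L\<^esub> z)"
        using xy by (simp add: frac_simps m_ac a_ac r_distr)
    qed (simp add: frac_simps)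
    show "comm_monoid L"
    proof (rule comm_monoidI)
      fix x y assume "x \<in> carrier L" "y \<in> carrier L"
      then obtain a s b t where xy: "a \<in> carrier R" "s \<in> S" "x = frac a s"
        "b \<in> carrier R" "t \<in> S" "y = frac b t" using frac_cases by metis
      show "x \<otimes>\<^bsub>L\<^esub> y \<in> carrier L" using xy by (simp add: frac_simps)
      show "x \<otimes>\<^bsub>L\<^esub> y = y \<otimes>\<^bsub>L\<^esub> x" using xy by (simp add: frac_simps m_comm)
      show "\<one>\<^bsub>L\<^esub> \<otimes>\<^bsub>L\<^esub> x = x" using xy by (simp add: frac_simps)
    next
      fix x y z assume "x \<in> carrier L" "y \<in> carrier L" "z \<in> carrier L"
      then obtain a s b t c u where xy: "a \<in> carrier R" "s \<in> S" "x = frac a s"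
        "b \<in> carrier R" "t \<in> S" "y = frac b t" "c \<in> carrier R" "u \<in> S" "z = frac c u"
        using frac_cases by metis
      show "x \<otimes>\<^bsub>L\<^esub> y \<otimes>\<^bsub>L\<^esub> z = x \<otimes>\<^bsub>L\<^esub> (y \<otimes>\<^bsub>L\<^esub> z)"
        using xy by (simp add: frac_simps m_assoc)
    qed (simp add: frac_simps)
    fix x y z assume "x \<in> carrier L" "y \<in> carrier L" "z \<in> carrier L"
    then obtain a s b t c u where xy: "a \<in> carrier R" "s \<in> S" "x = frac a s"
      "b \<in> carrier R" "t \<in> S" "y = frac b t" "c \<in> carrier R" "u \<in> S" "z = frac c u"
      using frac_cases by metis
    show "(x \<oplus>\<^bsub>L\<^esub> y) \<otimes>\<^bsub>L\<^esub> z = x \<otimes>\<^bsub>L\<^esub> z \<oplus>\<^bsub>L\<^esub> y \<otimes>\<^bsub>L\<^esub> z"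
      using xy by (simp add: frac_simps frac_eq_iff m_ac l_distr r_distr)
  qed
  moreover have "\<one>\<^bsub>L\<^esub> \<noteq> \<zero>\<^bsub>L\<^esub>" by (simp add: frac_simps frac_eq_iff)
  moreover have "x = \<zero>\<^bsub>L\<^esub> \<or> y = \<zero>\<^bsub>L\<^esub>"
    if xy: "x \<otimes>\<^bsub>L\<^esub> y = \<zero>\<^bsub>L\<^esub>" "x \<in> carrier L" "y \<in> carrier L" for x y
  proof -
    obtain a s b t where "a \<in> carrier R" "s \<in> S" "x = frac a s"
      "b \<in> carrier R" "t \<in> S" "y = frac b t" using frac_cases xy(2,3) by metis
    then show ?thesis using xy(1) integral[of a b] by (simp add: frac_simps frac_eq_iff)
  qed
  ultimately show ?thesis by (intro domain.intro domain_axioms.intro)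
qed

sublocale L: domain L by (rule L_domain)

lemma emb_hom: "emb \<in> ring_hom R L"
  by (rule ring_hom_memI) (simp_all add: frac_simps)

lemma emb_eq_iff [simp]: "a \<in> carrier R \<Longrightarrow> b \<in> carrier R \<Longrightarrow> emb a = emb b \<longleftrightarrow> a = b"
  by (simp add: frac_simps frac_eq_iff)

lemma emb_eq_zero [simp]: "a \<in> carrier R \<Longrightarrow> emb a = \<zero>\<^bsub>L\<^esub> \<longleftrightarrow> a = \<zero>"
  by (simp add: frac_simps frac_eq_iff)

lemma emb_Units:
  assumes "s \<in> S"
  shows "emb s \<in> Units L"
proof -
  have "emb s \<otimes>\<^bsub>L\<^esub> frac \<one> s = \<one>\<^bsub>L\<^esub>" "frac \<one> s \<otimes>\<^bsub>L\<^esub> emb s = \<one>\<^bsub>L\<^esub>"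
    using assms by (simp_all add: frac_simps frac_eq_iff)
  moreover have "emb s \<in> carrier L" "frac \<one> s \<in> carrier L" using assms by (simp_all add: carr one_mem)
  ultimately show ?thesis unfolding Units_def by blast
qed

lemma denominator:
  assumes "x \<in> carrier L"
  obtains a s where "a \<in> carrier R" "s \<in> S" "emb s \<otimes>\<^bsub>L\<^esub> x = emb a"
proof -
  obtain a s where as: "a \<in> carrier R" "s \<in> S" "x = frac a s" using assms frac_cases by blast
  then have "emb s \<otimes>\<^bsub>L\<^esub> x = emb a" by (simp add: frac_simps frac_eq_iff)
  with as that show thesis by blast
qed

sublocale emb: ring_hom_cring R L emb
  by unfold_locales (rule emb_hom)

end

context domain_localization begin

definition contraction :: "('a \<times> 'a) set set \<Rightarrow> 'a set"
  where "contraction J = {r \<in> carrier R. emb r \<in> J}"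

lemma contraction_ideal: "ideal J L \<Longrightarrow> ideal (contraction J) R"
  unfolding contraction_def by (rule emb.ring.ideal_vimage)

text \<open>An ideal of the localization is determined by its contraction, because the denominator \<open>s\<close> becomes
a unit.\<close>

lemma mem_iff_numerator_mem:
  assumes J: "ideal J L" and x: "x \<in> carrier L" and s: "s \<in> S" "a \<in> carrier R"
    and eq: "emb s \<otimes>\<^bsub>L\<^esub> x = emb a"
  shows "x \<in> J \<longleftrightarrow> a \<in> contraction J"
proof
  assume "x \<in> J"
  then have "emb a \<in> J"
    using ideal.I_l_closed[OF J, of x "emb s"] s carr by (simp flip: eq)
  then show "a \<in> contraction J" using s by (simp add: contraction_def)
next
  assume a: "a \<in> contraction J"
  have u: "emb s \<in> Units L" by (rule emb_Units[OF s(1)])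
  have "x = inv\<^bsub>L\<^esub> (emb s) \<otimes>\<^bsub>L\<^esub> (emb s \<otimes>\<^bsub>L\<^esub> x)"
    using u x L.Units_closed[OF u] by (simp flip: L.m_assoc)
  moreover have "inv\<^bsub>L\<^esub> (emb s) \<otimes>\<^bsub>L\<^esub> emb a \<in> J"
    using a u by (intro ideal.I_l_closed[OF J]) (auto simp: contraction_def)
  ultimately show "x \<in> J" using eq by simp
qed

lemma subset_if_contraction_subset:
  assumes J: "ideal J L" and K: "ideal K L" and sub: "contraction J \<subseteq> contraction K"
  shows "J \<subseteq> K"
proof
  fix x assume x: "x \<in> J"
  then have xc: "x \<in> carrier L" using J ideal.Icarr by fast
  then obtain a s where "a \<in> carrier R" "s \<in> S" "emb s \<otimes>\<^bsub>L\<^esub> x = emb a"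
    using denominator by blast
  then show "x \<in> K" using mem_iff_numerator_mem[OF _ xc] J K sub x by blast
qed

lemma L_noetherian:
  assumes "noetherian_ring R"
  shows "noetherian_ring L"
proof (rule L.trivial_ideal_chain_imp_noetherian)
  fix C assume C: "C \<noteq> {}" "subset.chain {I. ideal I L} C"
  then have id: "ideal J L" if "J \<in> C" for J using that by (auto simp: pred_on.chain_def)
  have mono: "contraction J \<subseteq> contraction K" if "J \<subseteq> K" for J K
    using that by (auto simp: contraction_def)
  have "subset.chain {I. ideal I R} (contraction ` C)"
    unfolding subset_chain_def
  proof (intro conjI ballI)
    show "contraction ` C \<subseteq> {I. ideal I R}" using id contraction_ideal by blast
    fix A B assume "A \<in> contraction ` C" "B \<in> contraction ` C"
    then obtain J K where "J \<in> C" "K \<in> C" "A = contraction J" "B = contraction K" by blast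
    moreover from this have "J \<subseteq> K \<or> K \<subseteq> J" using C(2) unfolding subset_chain_def by blast
    ultimately show "A \<subseteq> B \<or> B \<subseteq> A" using mono by blast
  qed
  then have "\<Union> (contraction ` C) \<in> contraction ` C"
    by (rule noetherian_ring.ideal_chain_is_trivial[OF assms, rotated]) (use C(1) in simp)
  then obtain J where J: "J \<in> C" "\<Union> (contraction ` C) = contraction J" by (rule imageE)
  have "K \<subseteq> J" if K: "K \<in> C" for K
  proof (rule subset_if_contraction_subset[OF id[OF K] id[OF J(1)]])
    show "contraction K \<subseteq> contraction J" unfolding J(2)[symmetric] using K by (rule UN_upper)
  qed
  then have "\<Union> C = J" using J(1) by (intro equalityI Union_least Union_upper)
  then show "\<Union> C \<in> C" using J(1) by (rule ssubst)
qed

lemma emb_pow: "a \<in> carrier R \<Longrightarrow> emb (a [^] (n::nat)) = emb a [^]\<^bsub>L\<^esub> n"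
  by (induction n) simp_all

lemma emb_forms:
  assumes x: "x \<in> carrier R" and b: "b \<in> carrier R" and int: "y \<in> forms x b n j"
  shows "emb y \<in> L.forms (emb x) (emb b) n j"
proof -
  have "forms x b n j \<subseteq> contraction (L.forms (emb x) (emb b) n j)"
    using x b by (intro forms_least contraction_ideal L.forms_ideal)
      (auto simp: contraction_def emb_pow intro!: L.forms_gen)
  then show ?thesis using int by (auto simp: contraction_def)
qed

lemma emb_mem_cgenideal:
  assumes u: "u \<in> carrier R" and v: "v \<in> carrier R" and "emb u \<in> PIdl\<^bsub>L\<^esub> (emb v)"
  obtains s where "s \<in> S" "s \<otimes> u \<in> PIdl v"
proof -
  obtain z where z: "z \<in> carrier L" "emb u = z \<otimes>\<^bsub>L\<^esub> emb v"
    using assms(3) by (auto simp: cgenideal_def)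
  obtain a s where as: "a \<in> carrier R" "s \<in> S" "emb s \<otimes>\<^bsub>L\<^esub> z = emb a"
    using denominator z by blast
  have "emb (s \<otimes> u) = emb s \<otimes>\<^bsub>L\<^esub> (z \<otimes>\<^bsub>L\<^esub> emb v)" using z as u carr by simp
  also have "\<dots> = (emb s \<otimes>\<^bsub>L\<^esub> z) \<otimes>\<^bsub>L\<^esub> emb v"
    using z as v carr by (simp flip: L.m_assoc)
  also have "\<dots> = emb (a \<otimes> v)" using as v by simp
  finally have "s \<otimes> u = a \<otimes> v" using as u v carr by (subst (asm) emb_eq_iff) auto
  then have "s \<otimes> u \<in> PIdl v" using as(1) mem_cgenideal by blast
  with as(2) that show thesis by blast
qed

end

section \<open>Localization at a prime\<close>

locale localization_at_prime = noetherian_domain R for R (structure) +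
  fixes P :: "'a set"
  assumes prime: "primeideal P R"
begin

sublocale P: primeideal P R by (rule prime)

sublocale domain_localization R "carrier R - P"
proof
  show "carrier R - P \<subseteq> carrier R - {\<zero>}" by auto
  show "\<one> \<in> carrier R - P" using P.I_notcarr P.one_imp_carrier by auto
  show "s \<otimes> t \<in> carrier R - P" if "s \<in> carrier R - P" "t \<in> carrier R - P" for s t
    using that P.I_prime by blast
qed

definition M where "M = {x \<in> carrier L. \<exists>a\<in>P. \<exists>s\<in>carrier R - P. emb s \<otimes>\<^bsub>L\<^esub> x = emb a}"

lemma emb_mem_M: "r \<in> carrier R \<Longrightarrow> emb r \<in> M \<longleftrightarrow> r \<in> P"
proof
  assume r: "r \<in> carrier R" and "emb r \<in> M"
  then obtain a s where as: "a \<in> P" "s \<in> carrier R - P" "emb s \<otimes>\<^bsub>L\<^esub> emb r = emb a"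
    by (auto simp: M_def)
  then have "emb (s \<otimes> r) = emb a" using r by simp
  then have "s \<otimes> r = a" using r as P.Icarr by (subst (asm) emb_eq_iff) auto
  then show "r \<in> P" using P.I_prime[of s r] as r by auto
next
  assume r: "r \<in> carrier R" "r \<in> P"
  then have "emb \<one> \<otimes>\<^bsub>L\<^esub> emb r = emb r" by simp
  then show "emb r \<in> M" using r one_mem frac_closed[OF r(1) one_mem] unfolding M_def by blast
qed

lemma M_ideal: "ideal M L"
proof (rule L.cring_idealI)
  show "M \<subseteq> carrier L" by (auto simp: M_def)
  show "\<zero>\<^bsub>L\<^esub> \<in> M" using emb_mem_M[of \<zero>] by simp
next
  fix x y assume "x \<in> M" "y \<in> M"
  then obtain a s b t where x: "x \<in> carrier L" "a \<in> P" "s \<in> carrier R - P" "emb s \<otimes>\<^bsub>L\<^esub> x = emb a"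
    and y: "y \<in> carrier L" "b \<in> P" "t \<in> carrier R - P" "emb t \<otimes>\<^bsub>L\<^esub> y = emb b"
    by (auto simp: M_def)
  have c: "a \<in> carrier R" "b \<in> carrier R" "s \<in> carrier R" "t \<in> carrier R"
    using x y P.Icarr by auto
  have "emb (s \<otimes> t) \<otimes>\<^bsub>L\<^esub> (x \<oplus>\<^bsub>L\<^esub> y)
    = emb t \<otimes>\<^bsub>L\<^esub> (emb s \<otimes>\<^bsub>L\<^esub> x) \<oplus>\<^bsub>L\<^esub> emb s \<otimes>\<^bsub>L\<^esub> (emb t \<otimes>\<^bsub>L\<^esub> y)"
    using c x(1) y(1) by (simp add: L.r_distr L.m_ac)
  also have "\<dots> = emb (t \<otimes> a \<oplus> s \<otimes> b)" using c x y by simp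
  finally have "emb (s \<otimes> t) \<otimes>\<^bsub>L\<^esub> (x \<oplus>\<^bsub>L\<^esub> y) = emb (t \<otimes> a \<oplus> s \<otimes> b)" .
  moreover have "t \<otimes> a \<oplus> s \<otimes> b \<in> P" using c x y P.I_l_closed by simp
  ultimately show "x \<oplus>\<^bsub>L\<^esub> y \<in> M"
    using mult_mem[OF x(3) y(3)] x(1) y(1) L.add.m_closed unfolding M_def by blast
next
  fix r x assume r: "r \<in> carrier L" and "x \<in> M"
  then obtain a s where x: "x \<in> carrier L" "a \<in> P" "s \<in> carrier R - P" "emb s \<otimes>\<^bsub>L\<^esub> x = emb a"
    by (auto simp: M_def)
  obtain b t where b: "b \<in> carrier R" "t \<in> carrier R - P" "emb t \<otimes>\<^bsub>L\<^esub> r = emb b"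
    using denominator r by blast
  have c: "a \<in> carrier R" "s \<in> carrier R" "t \<in> carrier R"
    using x b P.Icarr by auto
  have "emb (t \<otimes> s) \<otimes>\<^bsub>L\<^esub> (r \<otimes>\<^bsub>L\<^esub> x) = (emb t \<otimes>\<^bsub>L\<^esub> r) \<otimes>\<^bsub>L\<^esub> (emb s \<otimes>\<^bsub>L\<^esub> x)"
    using c x(1) r by (simp add: L.m_ac)
  also have "\<dots> = emb (b \<otimes> a)" using c x b by simp
  finally have "emb (t \<otimes> s) \<otimes>\<^bsub>L\<^esub> (r \<otimes>\<^bsub>L\<^esub> x) = emb (b \<otimes> a)" .
  then show "r \<otimes>\<^bsub>L\<^esub> x \<in> M"
    using mult_mem[OF b(2) x(3)] P.I_l_closed[OF x(2) b(1)] r x(1) L.m_closed unfolding M_def by blast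
qed

lemma proper_ideal_subset_M:
  assumes J: "ideal J L" "J \<noteq> carrier L"
  shows "J \<subseteq> M"
proof (rule subset_if_contraction_subset[OF J(1) M_ideal], rule subsetI)
  fix r assume "r \<in> contraction J"
  then have r: "r \<in> carrier R" "emb r \<in> J" by (auto simp: contraction_def)
  have "r \<in> P"
  proof (rule ccontr)
    assume "r \<notin> P"
    then have u: "emb r \<in> Units L" using emb_Units r by blast
    then have "inv\<^bsub>L\<^esub> (emb r) \<otimes>\<^bsub>L\<^esub> emb r \<in> J"
      using ideal.I_l_closed[OF J(1) r(2)] L.Units_inv_closed by blast
    then have "\<one>\<^bsub>L\<^esub> \<in> J" using u by simp
    then show False using ideal.one_imp_carrier[OF J(1)] J(2) by blast
  qed
  then show "r \<in> contraction M" using r emb_mem_M by (simp add: contraction_def)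
qed

lemma M_maximal: "maximalideal M L"
proof (rule maximalidealI[OF M_ideal])
  have "\<one>\<^bsub>L\<^esub> \<notin> M" using emb_mem_M[of \<one>] one_mem by simp
  then show "carrier L \<noteq> M" by auto
  fix J assume "ideal J L" "M \<subseteq> J" "J \<subseteq> carrier L"
  then show "J = M \<or> J = carrier L" using proper_ideal_subset_M by blast
qed

lemma max_ideal_L: "max_ideal L = M"
  unfolding max_ideal_def
proof (rule the_equality)
  show "maximalideal M L" by (rule M_maximal)
  fix N assume N: "maximalideal N L"
  interpret N: maximalideal N L by (rule N)
  have "N \<subseteq> M" using proper_ideal_subset_M[OF N.is_ideal] N.I_notcarr by blast
  moreover have "M \<noteq> carrier L" using maximalideal.I_notcarr[OF M_maximal] by blast
  ultimately show "N = M"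
    using N.I_maximal[OF M_ideal] L.ideal_subset[OF M_ideal] by blast
qed

lemma L_noetherian_domain: "noetherian_domain L"
  using L_noetherian[OF noetherian_ring_axioms] L_domain by (rule noetherian_domain.intro)

text \<open>A nonzero prime of the localization contracts to a nonzero prime inside \<open>P\<close>, which by minimality
is \<open>P\<close> itself.\<close>

lemma L_one_dim:
  assumes ht: "\<And>p. \<lbrakk>primeideal p R; p \<subseteq> P; p \<noteq> {\<zero>}\<rbrakk> \<Longrightarrow> p = P"
  shows "one_dim_local_domain L M"
proof (intro one_dim_local_domain.intro one_dim_local_domain_axioms.intro
    L_noetherian_domain M_maximal)
  fix J assume J: "primeideal J L" "J \<noteq> {\<zero>\<^bsub>L\<^esub>}"
  interpret J: primeideal J L by (rule J(1))
  have JM: "J \<subseteq> M" using proper_ideal_subset_M J.is_ideal J.I_notcarr by blast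
  have "primeideal (contraction J) R"
  proof (rule primeidealI[OF contraction_ideal[OF J.is_ideal] is_cring])
    have "emb \<one> \<notin> J" using J.one_imp_carrier J.I_notcarr by auto
    then have "\<one> \<notin> contraction J" by (simp add: contraction_def)
    then show "carrier R \<noteq> contraction J" by auto
    fix a b assume "a \<in> carrier R" "b \<in> carrier R" "a \<otimes> b \<in> contraction J"
    then show "a \<in> contraction J \<or> b \<in> contraction J"
      using J.I_prime[of "emb a" "emb b"] by (simp add: contraction_def one_mem)
  qed
  moreover have "contraction J \<subseteq> P" using JM emb_mem_M by (auto simp: contraction_def)
  moreover have "contraction J \<noteq> {\<zero>}"
  proof
    assume "contraction J = {\<zero>}"
    then have "J \<subseteq> {\<zero>\<^bsub>L\<^esub>}"
      using subset_if_contraction_subset[OF J.is_ideal L.zeroideal]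
      by (simp add: contraction_def)
    then show False using J(2) J.zero_closed by blast
  qed
  ultimately have "contraction J = P" using ht by blast
  then have "contraction M \<subseteq> contraction J" using emb_mem_M by (auto simp: contraction_def)
  then show "J = M"
    using subset_if_contraction_subset[OF M_ideal J.is_ideal] JM by blast
qed

text \<open>The class of \<open>c\<close> in \<open>L / bL\<close> is nonzero and killed by the maximal ideal, so \<open>L / bL\<close> has depth zero. To
see that every nonzero \<open>x\<close> in the maximal ideal can replace \<open>b\<close>, write \<open>xc = db\<close>: then \<open>d\<close> is not in \<open>xL\<close>, since
otherwise \<open>c\<close> would lie in \<open>bL\<close>, but every \<open>y\<close> in the maximal ideal satisfies \<open>yd \<in> xL\<close>.
Thus no regular sequence continues after \<open>x\<close>.\<close>

lemma depth_le_one: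
  assumes b: "b \<in> carrier R" "b \<noteq> \<zero>" and c: "c \<in> carrier R" "c \<notin> PIdl b"
    and P: "P = colon (PIdl b) c"
  shows "local_depth L \<le> 1"
proof -
  have P_iff: "r \<in> P \<longleftrightarrow> r \<in> carrier R \<and> r \<otimes> c \<in> PIdl b" for r
    unfolding P colon_def by simp
  have Pb: "ideal (PIdl\<^bsub>L\<^esub> (emb b)) L" by (rule L.cgenideal_ideal) (use b in simp)
  have eb: "emb b \<in> carrier L" "emb b \<noteq> \<zero>\<^bsub>L\<^esub>" "emb c \<in> carrier L" using b c by simp_all
  have kill: "\<exists>e\<in>carrier L. z \<otimes>\<^bsub>L\<^esub> emb c = e \<otimes>\<^bsub>L\<^esub> emb b" if z: "z \<in> M" for z
  proof -
    have "M \<subseteq> L.colon (PIdl\<^bsub>L\<^esub> (emb b)) (emb c)"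
    proof (rule subset_if_contraction_subset[OF M_ideal L.colon_ideal[OF Pb eb(3)]], rule subsetI)
      fix r assume "r \<in> contraction M"
      then have r: "r \<in> carrier R" "r \<in> P" using emb_mem_M by (auto simp: contraction_def)
      then obtain a where a: "a \<in> carrier R" "r \<otimes> c = a \<otimes> b"
        unfolding P_iff mem_cgenideal by blast
      have "emb r \<otimes>\<^bsub>L\<^esub> emb c = emb (r \<otimes> c)" using r c by simp
      also have "\<dots> = emb a \<otimes>\<^bsub>L\<^esub> emb b" unfolding a(2) using a b by simp
      finally have "emb r \<otimes>\<^bsub>L\<^esub> emb c = emb a \<otimes>\<^bsub>L\<^esub> emb b" .
      then show "r \<in> contraction (L.colon (PIdl\<^bsub>L\<^esub> (emb b)) (emb c))"
        using r(1) a(1) unfolding contraction_def L.colon_def L.mem_cgenideal by auto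
    qed
    then show ?thesis using z unfolding L.colon_def L.mem_cgenideal by blast
  qed
  have ec: "emb c \<notin> PIdl\<^bsub>L\<^esub> (emb b)"
  proof
    assume "emb c \<in> PIdl\<^bsub>L\<^esub> (emb b)"
    then obtain s where "s \<in> carrier R - P" "s \<otimes> c \<in> PIdl b"
      using emb_mem_cgenideal[OF c(1) b(1)] by blast
    then show False using P_iff by blast
  qed
  have "length xs \<le> 1" if xs: "set xs \<subseteq> M" "regular_sequence L xs" for xs
  proof (rule ccontr)
    assume "\<not> length xs \<le> 1"
    then have len: "0 < length xs" "1 < length xs" by auto
    define x y where "x = xs ! 0" and "y = xs ! 1"
    have xy: "x \<in> M" "y \<in> M" using xs(1) len nth_mem unfolding x_def y_def by blast+
    then have xyc: "x \<in> carrier L" "y \<in> carrier L" using L.ideal_subset[OF M_ideal] by blast+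
    have take1: "take 1 xs = [x]" using len by (cases xs) (auto simp: x_def)
    have reg: "\<And>i a. \<lbrakk>i < length xs; a \<in> carrier L; xs ! i \<otimes>\<^bsub>L\<^esub> a \<in> Idl\<^bsub>L\<^esub> (set (take i xs))\<rbrakk>
        \<Longrightarrow> a \<in> Idl\<^bsub>L\<^esub> (set (take i xs))"
      using xs(2) unfolding regular_sequence_def by blast
    have Idl0: "Idl\<^bsub>L\<^esub> {} \<subseteq> {\<zero>\<^bsub>L\<^esub>}" by (rule L.genideal_minimal[OF L.zeroideal]) simp
    have x0: "x \<noteq> \<zero>\<^bsub>L\<^esub>"
    proof
      assume "x = \<zero>\<^bsub>L\<^esub>"
      then have "x \<otimes>\<^bsub>L\<^esub> \<one>\<^bsub>L\<^esub> \<in> Idl\<^bsub>L\<^esub> {}"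
        using additive_subgroup.zero_closed[OF ideal.axioms(1)[OF L.genideal_ideal[of "{}"]]] by simp
      then have "\<one>\<^bsub>L\<^esub> \<in> Idl\<^bsub>L\<^esub> {}" using reg[of 0 "\<one>\<^bsub>L\<^esub>"] len by (simp add: x_def)
      then show False using Idl0 by auto
    qed
    obtain d where d: "d \<in> carrier L" "x \<otimes>\<^bsub>L\<^esub> emb c = d \<otimes>\<^bsub>L\<^esub> emb b" using kill xy by blast
    obtain f where f: "f \<in> carrier L" "y \<otimes>\<^bsub>L\<^esub> emb c = f \<otimes>\<^bsub>L\<^esub> emb b" using kill xy by blast
    have "emb b \<otimes>\<^bsub>L\<^esub> (y \<otimes>\<^bsub>L\<^esub> d) = y \<otimes>\<^bsub>L\<^esub> (d \<otimes>\<^bsub>L\<^esub> emb b)"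
      using xyc d(1) eb by (simp add: L.m_ac)
    also have "\<dots> = x \<otimes>\<^bsub>L\<^esub> (y \<otimes>\<^bsub>L\<^esub> emb c)"
      unfolding d(2)[symmetric] using xyc eb by (simp add: L.m_ac)
    also have "\<dots> = emb b \<otimes>\<^bsub>L\<^esub> (f \<otimes>\<^bsub>L\<^esub> x)" unfolding f(2) using xyc f(1) eb by (simp add: L.m_ac)
    finally have "y \<otimes>\<^bsub>L\<^esub> d = f \<otimes>\<^bsub>L\<^esub> x"
      using L.m_lcancel[of "emb b" "y \<otimes>\<^bsub>L\<^esub> d" "f \<otimes>\<^bsub>L\<^esub> x"] xyc d f eb by simp
    moreover have Idlx: "Idl\<^bsub>L\<^esub> (set (take 1 xs)) = PIdl\<^bsub>L\<^esub> x"
      using take1 L.cgenideal_eq_genideal[OF xyc(1)] by simp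
    ultimately have "d \<in> PIdl\<^bsub>L\<^esub> x"
      using reg[of 1 d] len d f by (auto simp: y_def L.mem_cgenideal)
    then obtain g where g: "g \<in> carrier L" "d = g \<otimes>\<^bsub>L\<^esub> x" by (auto simp: L.mem_cgenideal)
    have "x \<otimes>\<^bsub>L\<^esub> emb c = x \<otimes>\<^bsub>L\<^esub> (g \<otimes>\<^bsub>L\<^esub> emb b)"
      unfolding d(2) g(2) using g(1) xyc eb by (simp add: L.m_ac)
    then have "emb c = g \<otimes>\<^bsub>L\<^esub> emb b"
      using L.m_lcancel[of x "emb c" "g \<otimes>\<^bsub>L\<^esub> emb b"] x0 xyc g eb by simp
    then show False using ec g(1) by (auto simp: L.mem_cgenideal)
  qed
  then show ?thesis
    unfolding local_depth_def max_ideal_L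
    by (intro Sup_least) (auto simp: one_enat_def)
qed

end

context localization_at_prime begin

text \<open>The criterion for one-dimensional local domains, applied to the localization at a minimal nonzero
prime and expressed by elements of \<open>R\<close>.\<close>

lemma integral_division_local:
  assumes unram: "analytically_unramified (localization_at R P)"
    and ht: "\<And>p. \<lbrakk>primeideal p R; p \<subseteq> P; p \<noteq> {\<zero>}\<rbrakk> \<Longrightarrow> p = P"
    and t: "t \<in> P" "t \<noteq> \<zero>" and v: "v \<in> carrier R" "v \<noteq> \<zero>"
    and w: "\<And>n. w n \<in> carrier R" and a: "\<And>n. a n \<in> carrier R"
    and step: "\<And>n. w (Suc n) = w n \<oplus> a n \<otimes> (v \<otimes> t [^] n)"
    and int: "\<And>n. \<exists>k. w n [^] k \<in> forms (w n) (v \<otimes> t [^] n) k k"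
  shows "\<exists>s\<in>carrier R - P. s \<otimes> w 0 \<in> PIdl v"
proof -
  interpret A: one_dim_local_domain L M by (rule L_one_dim[OF ht])
  have tc: "t \<in> carrier R" using t P.Icarr by blast
  have b: "v \<otimes> t [^] n \<in> carrier R" for n :: nat using v tc by simp
  have bn: "emb (v \<otimes> t [^] n) = emb v \<otimes>\<^bsub>L\<^esub> emb t [^]\<^bsub>L\<^esub> n" for n :: nat
    using emb.hom_mult[OF v(1) nat_pow_closed[OF tc]] emb_pow[OF tc] by simp
  have "emb (w 0) \<in> PIdl\<^bsub>L\<^esub> (emb v)"
  proof (rule A.integral_division_mem)
    show "reduced_ring (adic_completion L M)"
      using unram unfolding analytically_unramified_def localization_at_def max_ideal_L .
    show "emb t \<in> M" by (rule emb_mem_M[OF tc, THEN iffD2, OF t(1)])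
    show "emb t \<noteq> \<zero>\<^bsub>L\<^esub>" unfolding emb_eq_zero[OF tc] by (rule t(2))
    show "emb v \<noteq> \<zero>\<^bsub>L\<^esub>" unfolding emb_eq_zero[OF v(1)] by (rule v(2))
    show "emb v \<in> carrier L" by (rule emb.hom_closed[OF v(1)])
    show "emb (w n) \<in> carrier L" "emb (a n) \<in> carrier L" for n
      by (rule emb.hom_closed[OF w], rule emb.hom_closed[OF a])
    show "emb (w (Suc n)) = emb (w n) \<oplus>\<^bsub>L\<^esub> emb (a n) \<otimes>\<^bsub>L\<^esub> (emb v \<otimes>\<^bsub>L\<^esub> emb t [^]\<^bsub>L\<^esub> n)" for n
      unfolding step bn[symmetric] emb.hom_add[OF w m_closed[OF a b]] emb.hom_mult[OF a b] ..
    show "\<exists>k. emb (w n) [^]\<^bsub>L\<^esub> k \<in> L.forms (emb (w n)) (emb v \<otimes>\<^bsub>L\<^esub> emb t [^]\<^bsub>L\<^esub> n) k k" for n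
    proof -
      obtain k where "w n [^] k \<in> forms (w n) (v \<otimes> t [^] n) k k" using int by blast
      from emb_forms[OF w b this] show ?thesis unfolding bn emb_pow[OF w] by (rule exI)
    qed
  qed
  then obtain s where "s \<in> carrier R - P" "s \<otimes> w 0 \<in> PIdl v"
    by (rule emb_mem_cgenideal[OF w v(1)])
  then show ?thesis by (rule bexI[rotated])
qed

end

section \<open>Primes of height one under Serre's condition\<close>

context noetherian_domain begin

lemma chain_le_prime_height:
  assumes "\<And>i. i \<le> n \<Longrightarrow> primeideal (c i) R" "\<And>i. i < n \<Longrightarrow> c i \<subset> c (Suc i)" "c n = P"
  shows "enat n \<le> prime_height R P"
  unfolding prime_height_def by (rule Sup_upper) (use assms in blast)

lemma prime_height_one_minimal:
  assumes P: "primeideal P R" "prime_height R P = 1"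
    and p: "primeideal p R" "p \<subseteq> P" "p \<noteq> {\<zero>}"
  shows "p = P"
proof (rule ccontr)
  assume "p \<noteq> P"
  define c where "c = (\<lambda>i::nat. if i = 0 then {\<zero>} else if i = 1 then p else P)"
  have zp: "{\<zero>} \<subset> p"
    using p additive_subgroup.zero_closed[OF ideal.axioms(1)[OF primeideal.axioms(1)[OF p(1)]]] by blast
  have "enat 2 \<le> prime_height R P"
  proof (rule chain_le_prime_height[of _ c])
    show "primeideal (c i) R" if "i \<le> 2" for i
      using P(1) p(1) zeroprimeideal by (simp add: c_def)
    show "c i \<subset> c (Suc i)" if "i < 2" for i
      using that zp p(2) \<open>p \<noteq> P\<close> by (cases i) (auto simp: c_def)
  qed (simp add: c_def)
  then show False using P(2) by (simp add: one_enat_def)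
qed

text \<open>Under \<open>(S\<^sub>2)\<close> the domain is the intersection of its localizations at primes of height one: if the
fraction \<open>u / v\<close> is not in \<open>R\<close>, then some height one prime \<open>P\<close> has \<open>u / v\<close> outside the
localization at \<open>P\<close>. Such a \<open>P\<close> is an ideal that is maximal among the annihilators
\<open>(vR : ru)\<close> of nonzero multiples of the class of \<open>u\<close> in \<open>R / vR\<close>. It is prime by maximality; the localization
at \<open>P\<close> has depth at most one, so by \<open>(S\<^sub>2)\<close> its height is at most one, and it contains \<open>v \<noteq> 0\<close>.\<close>

theorem serre_S2_height_one_prime:
  assumes S2: "serre_S2 R" and u: "u \<in> carrier R" and v: "v \<in> carrier R" "v \<noteq> \<zero>"
    and uv: "u \<notin> PIdl v"
  obtains P where "primeideal P R" "prime_height R P = 1"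
    and "\<And>s. s \<in> carrier R - P \<Longrightarrow> s \<otimes> u \<notin> PIdl v"
proof -
  have Pv: "ideal (PIdl v) R" using cgenideal_ideal v by blast
  define F where "F = {colon (PIdl v) (r \<otimes> u) | r. r \<in> carrier R \<and> r \<otimes> u \<notin> PIdl v}"
  have "\<one> \<otimes> u \<notin> PIdl v" using u uv by simp
  then have "colon (PIdl v) (\<one> \<otimes> u) \<in> F" unfolding F_def by blast
  moreover have "F \<subseteq> {I. ideal I R}" unfolding F_def using colon_ideal[OF Pv] u by auto
  ultimately obtain P where "P \<in> F" and max: "\<And>J. J \<in> F \<Longrightarrow> P \<subseteq> J \<Longrightarrow> J = P"
    using ideal_maximal_member[of F] by blast
  then obtain r where r: "r \<in> carrier R" "r \<otimes> u \<notin> PIdl v" "P = colon (PIdl v) (r \<otimes> u)"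
    unfolding F_def by blast
  have Pi: "ideal P R" unfolding r(3) using colon_ideal[OF Pv] r(1) u by blast
  have prime: "primeideal P R"
  proof (rule primeidealI[OF Pi is_cring])
    have "\<one> \<notin> P" unfolding r(3) colon_def using r u by simp
    then show "carrier R \<noteq> P" by auto
    fix a b assume ab: "a \<in> carrier R" "b \<in> carrier R" "a \<otimes> b \<in> P"
    show "a \<in> P \<or> b \<in> P"
    proof (cases "a \<in> P")
      case False
      then have nin: "a \<otimes> r \<otimes> u \<notin> PIdl v"
        using ab r(1) u unfolding r(3) colon_def by (simp add: m_assoc)
      have "colon (PIdl v) (a \<otimes> r \<otimes> u) \<in> F"
        unfolding F_def using nin ab(1) r(1) by blast
      moreover have "P \<subseteq> colon (PIdl v) (a \<otimes> r \<otimes> u)"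
      proof
        fix x assume "x \<in> P"
        then have x: "x \<in> carrier R" "x \<otimes> (r \<otimes> u) \<in> PIdl v" unfolding r(3) colon_def by auto
        have "x \<otimes> (a \<otimes> r \<otimes> u) = a \<otimes> (x \<otimes> (r \<otimes> u))" using x(1) ab r(1) u by (simp add: m_ac)
        then show "x \<in> colon (PIdl v) (a \<otimes> r \<otimes> u)"
          unfolding colon_def using x ideal.I_l_closed[OF Pv x(2) ab(1)] by simp
      qed
      ultimately have eq: "colon (PIdl v) (a \<otimes> r \<otimes> u) = P" by (rule max)
      have "b \<otimes> (a \<otimes> r \<otimes> u) = (a \<otimes> b) \<otimes> (r \<otimes> u)" using ab(1,2) r(1) u by (simp add: m_ac)
      moreover have "(a \<otimes> b) \<otimes> (r \<otimes> u) \<in> PIdl v" using ab(3) unfolding r(3) colon_def by blast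
      ultimately have "b \<in> colon (PIdl v) (a \<otimes> r \<otimes> u)" unfolding colon_def using ab(2) by simp
      then show ?thesis unfolding eq by blast
    qed simp
  qed
  interpret P: localization_at_prime R P
    by (intro localization_at_prime.intro localization_at_prime_axioms.intro
        noetherian_domain_axioms prime)
  have ru: "r \<otimes> u \<in> carrier R" using r u by simp
  have "local_depth (localization_at R P) \<le> 1"
    unfolding localization_at_def by (rule P.depth_le_one[OF v ru r(2,3)])
  then have "min 2 (prime_height R P) \<le> 1"
    using S2 prime unfolding serre_S2_def by (meson order_trans)
  moreover have "1 \<le> prime_height R P"
  proof -
    have "v \<otimes> (r \<otimes> u) \<in> PIdl v" using ru v m_comm[OF v(1) ru] mem_cgenideal by blast
    then have "v \<in> P" unfolding r(3) colon_def using v by simp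
    then have zP: "{\<zero>} \<subset> P"
      using v additive_subgroup.zero_closed[OF ideal.axioms(1)[OF Pi]] by blast
    have "enat 1 \<le> prime_height R P"
      by (rule chain_le_prime_height[of _ "\<lambda>i. if i = 0 then {\<zero>} else P"])
         (use zP prime zeroprimeideal in auto)
    then show ?thesis by (simp add: one_enat_def)
  qed
  ultimately have "prime_height R P = 1"
    by (cases "prime_height R P") (auto simp: min_def one_enat_def numeral_eq_enat split: if_splits)
  moreover have "s \<otimes> u \<notin> PIdl v" if s: "s \<in> carrier R - P" for s
  proof
    assume "s \<otimes> u \<in> PIdl v"
    then have "r \<otimes> (s \<otimes> u) \<in> PIdl v" using ideal.I_l_closed[OF Pv _ r(1)] by blast
    moreover have "r \<otimes> (s \<otimes> u) = s \<otimes> (r \<otimes> u)" using s r(1) u by (simp add: m_lcomm)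
    ultimately have "s \<in> P" unfolding r(3) colon_def using s by simp
    then show False using s by blast
  qed
  ultimately show thesis using that prime by blast
qed

end

section \<open>Homomorphisms from the fraction field\<close>

text \<open>The unqualified constants of \<open>domain_localization\<close> refer to the fraction field here; a separate
locale keeps this choice away from \<^locale>\<open>localization_at_prime\<close>, which extends the same
base locale with another set of denominators.\<close>

locale noetherian_domain_fractions = noetherian_domain R for R (structure)
begin

sublocale domain_localization R "carrier R - {\<zero>}"
  by unfold_locales (auto simp: integral_iff)

abbreviation Q where "Q \<equiv> L"

lemma frac_field_eq: "frac_field R = Q" and frac_embed_eq: "frac_embed R = emb"
  by (simp_all add: frac_field_def frac_embed_def fun_eq_iff)

text \<open>With \<open>y = x / b\<close>, each term \<open>c y\<^sup>l\<close> of the polynomial has \<open>l < length p\<close>, and multiplying it by \<open>b\<^sup>n\<close> turns it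
into a multiple of the monomial \<open>x\<^sup>l b\<^sup>n\<^sup>-\<^sup>l\<close>.\<close>

lemma eval_clear_denominators:
  assumes x: "x \<in> carrier R" and b: "b \<in> carrier R" and y: "y \<in> carrier Q"
    and eq: "emb b \<otimes>\<^bsub>Q\<^esub> y = emb x"
    and p: "set p \<subseteq> emb ` carrier R" "length p \<le> n"
  shows "L.eval p y \<in> carrier Q \<and>
    (\<exists>r\<in>forms x b n (length p). emb (b [^] n) \<otimes>\<^bsub>Q\<^esub> L.eval p y = emb r)"
  using p
proof (induction p)
  case Nil
  have "\<zero> \<in> forms x b n 0"
    using additive_subgroup.zero_closed[OF ideal.axioms(1)[OF forms_ideal[OF x b]]] .
  then have "\<exists>r\<in>forms x b n 0. \<zero>\<^bsub>Q\<^esub> = emb r" by (rule bexI[rotated]) simp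
  then show ?case using b by simp
next
  case (Cons c p)
  let ?l = "length p"
  obtain a where a: "a \<in> carrier R" "c = emb a" using Cons.prems by auto
  obtain r where r: "r \<in> forms x b n ?l" "emb (b [^] n) \<otimes>\<^bsub>Q\<^esub> L.eval p y = emb r"
    and ev: "L.eval p y \<in> carrier Q" using Cons by auto
  have rc: "r \<in> carrier R" by (rule ideal.Icarr[OF forms_ideal[OF x b] r(1)])
  have l: "?l < n" using Cons.prems by simp
  have pw: "emb (b [^] n) \<otimes>\<^bsub>Q\<^esub> (y [^]\<^bsub>Q\<^esub> ?l) = emb (x [^] ?l \<otimes> b [^] (n - ?l))"
  proof -
    have "b [^] n = b [^] ?l \<otimes> b [^] (n - ?l)" using nat_pow_mult[OF b, of ?l "n - ?l"] l by simp
    then have "emb (b [^] n) \<otimes>\<^bsub>Q\<^esub> (y [^]\<^bsub>Q\<^esub> ?l)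
      = (emb b [^]\<^bsub>Q\<^esub> ?l \<otimes>\<^bsub>Q\<^esub> y [^]\<^bsub>Q\<^esub> ?l) \<otimes>\<^bsub>Q\<^esub> emb (b [^] (n - ?l))"
      using b y by (simp add: emb_pow L.m_ac)
    also have "\<dots> = (emb b \<otimes>\<^bsub>Q\<^esub> y) [^]\<^bsub>Q\<^esub> ?l \<otimes>\<^bsub>Q\<^esub> emb (b [^] (n - ?l))"
      using b y by (simp add: L.nat_pow_distrib)
    also have "\<dots> = emb (x [^] ?l \<otimes> b [^] (n - ?l))" unfolding eq using x b by (simp add: emb_pow)
    finally show ?thesis .
  qed
  let ?g = "x [^] ?l \<otimes> b [^] (n - ?l)"
  have gc: "?g \<in> carrier R" using x b by simp
  have yl: "y [^]\<^bsub>Q\<^esub> ?l \<in> carrier Q" using y by simp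
  have ec: "emb a \<in> carrier Q" "emb (b [^] n) \<in> carrier Q" using a b by simp_all
  have evc: "L.eval (c # p) y = emb a \<otimes>\<^bsub>Q\<^esub> y [^]\<^bsub>Q\<^esub> ?l \<oplus>\<^bsub>Q\<^esub> L.eval p y" using a by simp
  have "emb (b [^] n) \<otimes>\<^bsub>Q\<^esub> L.eval (c # p) y
      = emb a \<otimes>\<^bsub>Q\<^esub> (emb (b [^] n) \<otimes>\<^bsub>Q\<^esub> y [^]\<^bsub>Q\<^esub> ?l) \<oplus>\<^bsub>Q\<^esub> emb (b [^] n) \<otimes>\<^bsub>Q\<^esub> L.eval p y"
    unfolding evc using ec yl ev by (simp only: L.r_distr L.m_closed L.m_lcomm)
  also have "\<dots> = emb (a \<otimes> ?g \<oplus> r)" unfolding pw r(2) using a gc rc by (simp del: emb_eq_iff)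
  finally have "emb (b [^] n) \<otimes>\<^bsub>Q\<^esub> L.eval (c # p) y = emb (a \<otimes> ?g \<oplus> r)" .
  moreover have "a \<otimes> ?g \<oplus> r \<in> forms x b n (Suc ?l)"
  proof -
    have "?g \<in> forms x b n (Suc ?l)" by (rule forms_gen[OF x b]) simp
    then have "a \<otimes> ?g \<in> forms x b n (Suc ?l)" using ideal.I_l_closed[OF forms_ideal[OF x b] _ a(1)] by blast
    moreover have "r \<in> forms x b n (Suc ?l)" using forms_mono[OF x b, of ?l "Suc ?l" n] r(1) by auto
    ultimately show ?thesis by (rule additive_subgroup.a_closed[OF ideal.axioms(1)[OF forms_ideal[OF x b]]])
  qed
  moreover have "L.eval (c # p) y \<in> carrier Q" unfolding evc using ec yl ev by (intro L.a_closed L.m_closed)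
  ultimately show ?case by auto
qed

lemma integral_closure_forms:
  assumes y: "y \<in> integral_closure R" and x: "x \<in> carrier R" and b: "b \<in> carrier R"
    and eq: "emb b \<otimes>\<^bsub>Q\<^esub> y = emb x"
  shows "\<exists>k. x [^] k \<in> forms x b k k"
proof -
  obtain p where yc: "y \<in> carrier Q" and p: "p \<noteq> []" "polynomial\<^bsub>Q\<^esub> (emb ` carrier R) p"
    "lead_coeff p = \<one>\<^bsub>Q\<^esub>" "L.eval p y = \<zero>\<^bsub>Q\<^esub>"
    using y unfolding integral_closure_def frac_field_eq frac_embed_eq by blast
  obtain p' where p': "p = \<one>\<^bsub>Q\<^esub> # p'" using p(1,3) by (cases p) auto
  define k where "k = length p'"
  have "set p' \<subseteq> emb ` carrier R" using p(2) unfolding p' polynomial_def by auto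
  then obtain r where ev: "L.eval p' y \<in> carrier Q" and r: "r \<in> forms x b k k"
    "emb (b [^] k) \<otimes>\<^bsub>Q\<^esub> L.eval p' y = emb r"
    using eval_clear_denominators[OF x b yc eq, of p' k] unfolding k_def by blast
  have rc: "r \<in> carrier R" by (rule ideal.Icarr[OF forms_ideal[OF x b] r(1)])
  have bk: "emb (b [^] k) \<in> carrier Q" using b by simp
  have "y [^]\<^bsub>Q\<^esub> k \<oplus>\<^bsub>Q\<^esub> L.eval p' y = \<zero>\<^bsub>Q\<^esub>" using p(4) yc unfolding p' by (simp add: k_def)
  then have "emb (b [^] k) \<otimes>\<^bsub>Q\<^esub> y [^]\<^bsub>Q\<^esub> k \<oplus>\<^bsub>Q\<^esub> emb r = \<zero>\<^bsub>Q\<^esub>"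
    using L.r_distr[OF L.nat_pow_closed[OF yc, of k] ev bk] bk unfolding r(2) by simp
  moreover have "emb (b [^] k) \<otimes>\<^bsub>Q\<^esub> y [^]\<^bsub>Q\<^esub> k = emb (x [^] k)"
  proof -
    have "emb (b [^] k) \<otimes>\<^bsub>Q\<^esub> y [^]\<^bsub>Q\<^esub> k = (emb b \<otimes>\<^bsub>Q\<^esub> y) [^]\<^bsub>Q\<^esub> k"
      using b yc by (simp add: emb_pow L.nat_pow_distrib)
    then show ?thesis unfolding eq using x by (simp add: emb_pow)
  qed
  ultimately have "emb (x [^] k \<oplus> r) = \<zero>\<^bsub>Q\<^esub>" using x rc by simp
  then have "x [^] k \<oplus> r = \<zero>" using x rc by (subst (asm) emb_eq_zero) auto
  then have "x [^] k \<oplus> r \<in> forms x b k k"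
    using additive_subgroup.zero_closed[OF ideal.axioms(1)[OF forms_ideal[OF x b]]] by simp
  then have "x [^] k \<in> forms x b k k"
    by (rule set_add_diff[OF forms_ideal[OF x b] _ r(1)]) (use x in simp)
  then show ?thesis by blast
qed

definition coset :: "('a \<times> 'a) set \<Rightarrow> ('a \<times> 'a) set set"
  where "coset y = {emb r \<oplus>\<^bsub>Q\<^esub> y | r. r \<in> carrier R}"

lemma coset_self: "y \<in> carrier Q \<Longrightarrow> y \<in> coset y"
  unfolding coset_def by (rule CollectI, rule exI[of _ \<zero>]) simp

lemma carrier_frac_module: "carrier (frac_module R) = carrier Q"
  by (simp add: frac_module_def ring.defs frac_field_eq)

lemma smult_frac_module: "r \<odot>\<^bsub>frac_module R\<^esub> x = emb r \<otimes>\<^bsub>Q\<^esub> x"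
  by (simp add: frac_module_def ring.defs module.defs frac_field_eq frac_embed_eq)

lemma add_frac_module: "x \<oplus>\<^bsub>frac_module R\<^esub> y = x \<oplus>\<^bsub>Q\<^esub> y"
  by (simp add: frac_module_def ring.defs frac_field_eq)

lemma integral_closure_mod_ring_simps:
  shows "carrier (integral_closure_mod_ring R) = coset ` integral_closure R"
    and "r \<odot>\<^bsub>integral_closure_mod_ring R\<^esub> U = (\<Union>x\<in>U. coset (emb r \<otimes>\<^bsub>Q\<^esub> x))"
    and "\<zero>\<^bsub>integral_closure_mod_ring R\<^esub> = emb ` carrier R"
proof -
  have coset: "(emb ` carrier R) +>\<^bsub>(frac_module R)\<lparr>carrier := integral_closure R\<rparr>\<^esub> y = coset y" for y
    using add_frac_module by (auto simp: a_r_coset_def' coset_def)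
  show "carrier (integral_closure_mod_ring R) = coset ` integral_closure R"
    by (auto simp: integral_closure_mod_ring_def quotient_module_def frac_embed_eq coset A_RCOSETS_def')
  show "r \<odot>\<^bsub>integral_closure_mod_ring R\<^esub> U = (\<Union>x\<in>U. coset (emb r \<otimes>\<^bsub>Q\<^esub> x))"
    by (simp add: integral_closure_mod_ring_def quotient_module_def frac_embed_eq coset smult_frac_module)
  show "\<zero>\<^bsub>integral_closure_mod_ring R\<^esub> = emb ` carrier R"
    by (simp add: integral_closure_mod_ring_def quotient_module_def frac_embed_eq)
qed

lemma integral_closure_carrier: "y \<in> integral_closure R \<Longrightarrow> y \<in> carrier Q"
  by (simp add: integral_closure_def frac_field_eq)

lemma mod_hom_closed:
  assumes "f \<in> mod_hom R (frac_module R) N" "x \<in> carrier Q"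
  shows "f x \<in> carrier N"
proof -
  have "f \<in> carrier (frac_module R) \<rightarrow> carrier N"
    using assms(1) unfolding mod_hom_def hom_def by simp
  then show ?thesis using assms(2) unfolding carrier_frac_module by (rule funcset_mem)
qed

lemma mod_hom_smult:
  assumes "f \<in> mod_hom R (frac_module R) N" "x \<in> carrier Q" "r \<in> carrier R"
  shows "f (emb r \<otimes>\<^bsub>Q\<^esub> x) = r \<odot>\<^bsub>N\<^esub> f x"
proof -
  have "\<forall>r\<in>carrier R. \<forall>x\<in>carrier Q. f (emb r \<otimes>\<^bsub>Q\<^esub> x) = r \<odot>\<^bsub>N\<^esub> f x"
    using assms(1) unfolding mod_hom_def carrier_frac_module smult_frac_module by simp
  then show ?thesis using assms(2,3) by blast
qed

text \<open>Since \<open>Q\<close> is divisible, the elements \<open>f (q / t\<^sup>n)\<close> have representatives \<open>y\<^sub>n\<close> in the integral closure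
with \<open>t y\<^sub>n\<^sub>+\<^sub>1 = a\<^sub>n + y\<^sub>n\<close> and \<open>a\<^sub>n \<in> R\<close>. Clearing denominators, \<open>w\<^sub>n = v t\<^sup>n y\<^sub>n\<close> is a sequence in \<open>R\<close> that
starts with \<open>u\<close> and satisfies the hypotheses of the criterion for the localization at \<open>P\<close>.\<close>

lemma local_divisibility:
  assumes unram: "analytically_unramified_codim_one R"
    and P: "primeideal P R" "prime_height R P = 1"
    and f: "f \<in> mod_hom R (frac_module R) (integral_closure_mod_ring R)"
    and q: "q \<in> carrier Q" and y: "y \<in> integral_closure R" "f q = coset y"
    and u: "u \<in> carrier R" and v: "v \<in> carrier R" "v \<noteq> \<zero>" and eq: "emb v \<otimes>\<^bsub>Q\<^esub> y = emb u"
  shows "\<exists>s\<in>carrier R - P. s \<otimes> u \<in> PIdl v"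
proof -
  interpret P: localization_at_prime R P
    by (intro localization_at_prime.intro localization_at_prime_axioms.intro
        noetherian_domain_axioms P(1))
  have f_closed: "\<exists>y\<in>integral_closure R. f x = coset y" if "x \<in> carrier Q" for x
  proof -
    have "f x \<in> carrier (integral_closure_mod_ring R)" by (rule mod_hom_closed[OF f that])
    then show ?thesis unfolding integral_closure_mod_ring_simps by blast
  qed
  have f_smult: "f (emb r \<otimes>\<^bsub>Q\<^esub> x) = (\<Union>z\<in>f x. coset (emb r \<otimes>\<^bsub>Q\<^esub> z))"
    if "x \<in> carrier Q" "r \<in> carrier R" for r x
    using mod_hom_smult[OF f that] unfolding integral_closure_mod_ring_simps .
  \<comment> \<open>\<open>P \<noteq> 0\<close>, as the zero ideal has height zero.\<close>
  have "P \<noteq> {\<zero>}"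
  proof
    assume P0: "P = {\<zero>}"
    have "prime_height R P \<le> 0"
      unfolding prime_height_def
    proof (rule Sup_least, clarify)
      fix n and c :: "nat \<Rightarrow> 'a set"
      assume c: "\<forall>i\<le>n. primeideal (c i) R" "\<forall>i<n. c i \<subset> c (Suc i)" "P = c n"
      have "n = 0"
      proof (rule ccontr)
        assume "n \<noteq> 0"
        then obtain m where m: "n = Suc m" by (cases n) auto
        then have "c m \<subset> {\<zero>}" using c P0 by auto
        moreover have "\<zero> \<in> c m"
        proof -
          have "primeideal (c m) R" using c(1) m by simp
          then show ?thesis
            by (intro additive_subgroup.zero_closed ideal.axioms(1) primeideal.axioms(1))
        qed
        ultimately show False by blast
      qed
      then show "enat n \<le> 0" by (simp add: zero_enat_def)
    qed
    then show False using P(2) by simp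
  qed
  then obtain t where t: "t \<in> P" "t \<noteq> \<zero>" using P.P.zero_closed by blast
  have tc: "t \<in> carrier R" using t P.P.Icarr by blast
  have tS: "t \<in> carrier R - {\<zero>}" using t tc by blast
  have tU: "emb t \<in> Units Q" by (rule emb_Units[OF tS])
  have ti: "inv\<^bsub>Q\<^esub> (emb t) \<in> carrier Q" using tU by simp
  have tQ: "emb t \<in> carrier Q" using tU by blast
  define qs where "qs = (\<lambda>n::nat. q \<otimes>\<^bsub>Q\<^esub> inv\<^bsub>Q\<^esub> (emb t) [^]\<^bsub>Q\<^esub> n)"
  have qsc: "qs n \<in> carrier Q" for n unfolding qs_def using q ti by simp
  have qs_step: "emb t \<otimes>\<^bsub>Q\<^esub> qs (Suc n) = qs n" for n
  proof -
    have "emb t \<otimes>\<^bsub>Q\<^esub> qs (Suc n) = qs n \<otimes>\<^bsub>Q\<^esub> (emb t \<otimes>\<^bsub>Q\<^esub> inv\<^bsub>Q\<^esub> (emb t))"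
      unfolding qs_def using q ti tQ by (simp del: L.Units_r_inv L.Units_l_inv add: L.m_ac)
    then show ?thesis using tU qsc by simp
  qed
  have "\<exists>z. \<forall>n. z n \<in> integral_closure R \<and> f (qs n) = coset (z n)"
    using f_closed[OF qsc] by metis
  then obtain z where z: "\<And>n. z n \<in> integral_closure R" "\<And>n. f (qs n) = coset (z n)" by blast
  \<comment> \<open>The first representative is the given \<open>y\<close>, so that the sequence \<open>w\<close> starts with \<open>u\<close>.\<close>
  define ys where "ys = (\<lambda>n::nat. if n = 0 then y else z n)"
  have ys: "ys n \<in> integral_closure R" "f (qs n) = coset (ys n)" for n
    using z[of n] y q by (auto simp: ys_def qs_def)
  have ysc: "ys n \<in> carrier Q" for n using ys(1) integral_closure_carrier by blast
  have "\<exists>a\<in>carrier R. emb t \<otimes>\<^bsub>Q\<^esub> ys (Suc n) = emb a \<oplus>\<^bsub>Q\<^esub> ys n" for n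
  proof -
    have "emb t \<otimes>\<^bsub>Q\<^esub> ys (Suc n) \<in> coset (emb t \<otimes>\<^bsub>Q\<^esub> ys (Suc n))"
      using coset_self[of "emb t \<otimes>\<^bsub>Q\<^esub> ys (Suc n)"] tQ ysc by blast
    then have "emb t \<otimes>\<^bsub>Q\<^esub> ys (Suc n) \<in> f (emb t \<otimes>\<^bsub>Q\<^esub> qs (Suc n))"
      unfolding f_smult[OF qsc tc] ys(2) using coset_self[OF ysc] by blast
    then show ?thesis unfolding qs_step ys(2) coset_def by blast
  qed
  then obtain a where a: "\<And>n. a n \<in> carrier R"
    and a_step: "\<And>n. emb t \<otimes>\<^bsub>Q\<^esub> ys (Suc n) = emb (a n) \<oplus>\<^bsub>Q\<^esub> ys n" by metis
  define w where "w = rec_nat u (\<lambda>n x. x \<oplus> a n \<otimes> (v \<otimes> t [^] n))"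
  have w0: "w 0 = u" and w_step: "w (Suc n) = w n \<oplus> a n \<otimes> (v \<otimes> t [^] n)" for n
    by (simp_all add: w_def)
  have wc: "w n \<in> carrier R" for n
    by (induction n) (use u v a tc in \<open>simp_all add: w0 w_step\<close>)
  have b: "v \<otimes> t [^] n \<in> carrier R" for n :: nat using v tc by simp
  have w_eq: "emb (v \<otimes> t [^] n) \<otimes>\<^bsub>Q\<^esub> ys n = emb (w n)" for n
  proof (induction n)
    case 0
    then show ?case using eq v by (simp add: w0 ys_def)
  next
    case (Suc n)
    have bq: "emb (v \<otimes> t [^] n) \<in> carrier Q" and aq: "emb (a n) \<in> carrier Q" using b a by simp_all
    have "v \<otimes> t [^] Suc n = (v \<otimes> t [^] n) \<otimes> t" using v tc by (simp add: m_assoc)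
    then have "emb (v \<otimes> t [^] Suc n) = emb (v \<otimes> t [^] n) \<otimes>\<^bsub>Q\<^esub> emb t"
      using emb.hom_mult[OF b tc] by simp
    then have "emb (v \<otimes> t [^] Suc n) \<otimes>\<^bsub>Q\<^esub> ys (Suc n)
        = emb (v \<otimes> t [^] n) \<otimes>\<^bsub>Q\<^esub> (emb t \<otimes>\<^bsub>Q\<^esub> ys (Suc n))"
      using bq tQ ysc by (simp only: L.m_assoc)
    also have "\<dots> = emb (v \<otimes> t [^] n) \<otimes>\<^bsub>Q\<^esub> emb (a n) \<oplus>\<^bsub>Q\<^esub> emb (w n)"
      unfolding a_step Suc[symmetric] using bq aq ysc by (simp only: L.r_distr)
    also have "\<dots> = emb (w (Suc n))"
    proof -
      have "w (Suc n) = (v \<otimes> t [^] n) \<otimes> a n \<oplus> w n"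
        unfolding w_step using wc a b by (simp add: a_comm m_comm)
      then show ?thesis using emb.hom_mult[OF b a] emb.hom_add[OF m_closed[OF b a] wc] by simp
    qed
    finally show ?case .
  qed
  have "\<exists>s\<in>carrier R - P. s \<otimes> w 0 \<in> PIdl v"
  proof (rule P.integral_division_local)
    show "analytically_unramified (localization_at R P)"
      using unram P unfolding analytically_unramified_codim_one_def by blast
    show "p = P" if "primeideal p R" "p \<subseteq> P" "p \<noteq> {\<zero>}" for p
      using prime_height_one_minimal[OF P that] .
    show "\<exists>k. w n [^] k \<in> forms (w n) (v \<otimes> t [^] n) k k" for n
      using integral_closure_forms[OF ys(1) wc b w_eq] .
  qed (use t v wc a w_step in simp_all)
  then show ?thesis unfolding w0 .
qed

theorem h_reduced_integral_closure_mod_ring: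
  assumes unram: "analytically_unramified_codim_one R" and S2: "serre_S2 R"
  shows "h_reduced R (integral_closure_mod_ring R)"
  unfolding h_reduced_def carrier_frac_module integral_closure_mod_ring_simps(3)
proof (intro ballI)
  fix f q
  assume f: "f \<in> mod_hom R (frac_module R) (integral_closure_mod_ring R)" and q: "q \<in> carrier Q"
  have "f q \<in> carrier (integral_closure_mod_ring R)" by (rule mod_hom_closed[OF f q])
  then obtain y where y: "y \<in> integral_closure R" "f q = coset y"
    unfolding integral_closure_mod_ring_simps by blast
  have yc: "y \<in> carrier Q" using integral_closure_carrier y by blast
  obtain u v where u: "u \<in> carrier R" and v: "v \<in> carrier R - {\<zero>}" "emb v \<otimes>\<^bsub>Q\<^esub> y = emb u"
    using denominator[OF yc] by blast
  have v': "v \<in> carrier R" "v \<noteq> \<zero>" using v(1) by auto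
  have "u \<in> PIdl v"
  proof (rule ccontr)
    assume "u \<notin> PIdl v"
    then obtain P where P: "primeideal P R" "prime_height R P = 1"
      and no: "\<And>s. s \<in> carrier R - P \<Longrightarrow> s \<otimes> u \<notin> PIdl v"
      using serre_S2_height_one_prime[OF S2 u v'] by blast
    then show False using local_divisibility[OF unram P f q y u v' v(2)] by blast
  qed
  then obtain r where r: "r \<in> carrier R" "u = r \<otimes> v" by (auto simp: mem_cgenideal)
  have ec: "emb v \<in> carrier Q" "emb r \<in> carrier Q" using v' r by simp_all
  have "emb v \<otimes>\<^bsub>Q\<^esub> y = emb v \<otimes>\<^bsub>Q\<^esub> emb r"
    unfolding v(2) r(2) using emb.hom_mult[OF r(1) v'(1)] L.m_comm[OF ec] by simp
  moreover have "emb v \<noteq> \<zero>\<^bsub>Q\<^esub>" using v' emb_eq_zero by blast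
  ultimately have yr: "y = emb r" using L.m_lcancel[of "emb v" y "emb r"] ec yc by simp
  show "f q = emb ` carrier R"
  proof (intro equalityI subsetI)
    fix x assume "x \<in> f q"
    then obtain s where s: "s \<in> carrier R" "x = emb s \<oplus>\<^bsub>Q\<^esub> emb r"
      unfolding y(2) coset_def yr by blast
    then have "x = emb (s \<oplus> r)" using emb.hom_add[OF s(1) r(1)] by simp
    then show "x \<in> emb ` carrier R" using s r by blast
  next
    fix x assume "x \<in> emb ` carrier R"
    then obtain s where s: "s \<in> carrier R" "x = emb s" by blast
    have "s = (s \<ominus> r) \<oplus> r" using s r by algebra
    then have "x = emb (s \<ominus> r) \<oplus>\<^bsub>Q\<^esub> emb r"
      using emb.hom_add[OF minus_closed[OF s(1) r(1)] r(1)] s by simp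
    then show "x \<in> f q" unfolding y(2) coset_def yr using s r by blast
  qed
qed

end

theorem proposition5p2:
  fixes R :: "('a, 'm) ring_scheme" and \<mm> :: "'a set"
  assumes "noetherian_domain R"
    and "local_ring R \<mm>"
    and "analytically_unramified_codim_one R"
    and "serre_S2 R"
  shows "h_reduced R (integral_closure_mod_ring R)"
proof -
  interpret noetherian_domain_fractions R
    by (rule noetherian_domain_fractions.intro) fact
  show ?thesis using assms(3,4) by (rule h_reduced_integral_closure_mod_ring)
qed

end
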